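(* Let $0\ne p\in\mathbb C[z,w]$ with total-degree decomposition $p=p_a+p_{a+1}+\cdots+p_b$, $p_j\in H_j$, $p_a\ne0$, $p_b\ne0$, and let $\mathcal M=[p]$. (i) The map defined on polynomials by $U_ph=\frac{p}{\|p\|_2}h$ extends to a unitary $U_p:\mathscr H_p\to\mathcal M$ satisfying $U_pS_z=R_zU_p$ and $U_pS_w=R_wU_p$. (ii) Under this unitary, $$U_p^*P_zU_p=Q_z,\qquad U_p^*P_wU_p=Q_w,$$ $$U_p^*X_{\mathcal M}U_p=[S_z^*,S_w],\qquad U_p^*C_{\mathcal M}U_p=I-S_zS_z^*-S_wS_w^*+S_zS_wS_z^*S_w^* .$$ (iii) If $h\in H_m$ and $g\in H_n$, then $$\langle h,g\rangle_{\nu_p}=\frac1{\|p\|_2^2}\sum_{\substack{a\le r,s\le b\\ m+r=n+s}}\langle p_rh,p_sg\rangle_{H^2(\mathbb D^2)} .$$ Consequently $H_m\perp H_n$ in $\mathscr H_p$ whenever $|m-n|>b-a$. (iv) The spaces $H_0,H_1,\ldots$ are mutually orthogonal in $\mathscr H_p$ if and only if $p$ is homogeneous.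
   Context: $H^2(\mathbb D^2)$ is the Hardy space of the bidisc (inner products linear in the first variable), and $[p]$ is the closure of $p\,\mathbb C[z,w]$ in it. $H_n=\operatorname{span}\{z^jw^{n-j}:0\le j\le n\}$. For $\mathcal M=[p]$: $R_z,R_w$ are the restrictions to $\mathcal M$ of multiplication by $z,w$; $P_z=P_{\mathcal M\ominus z\mathcal M}$, $P_w=P_{\mathcal M\ominus w\mathcal M}$; $X_{\mathcal M}=[R_z^*,R_w]=R_z^*R_w-R_wR_z^*$; $C_{\mathcal M}=I-R_zR_z^*-R_wR_w^*+R_zR_wR_z^*R_w^*$. With normalized Haar measure on $\mathbb T^2$ denoted $dm$ and $\|p\|_2$ the norm of $p$ in $L^2(\mathbb T^2,m)$, let $d\nu_p=\frac{|p|^2}{\|p\|_2^2}dm$, a probability measure on $\mathbb T^2$, and let $\mathscr H_p=P^2(\nu_p)$ be the closure of $\mathbb C[z,w]$ in $L^2(\nu_p)$. $S_z,S_w$ denote multiplication by $z,w$ on $\mathscr H_p$ (commuting isometries), and $Q_z,Q_w$ the orthogonal projections of $\mathscr H_p$ onto $\mathscr H_p\ominus z\mathscr H_p$ and $\mathscr H_p\ominus w\mathscr H_p$. *)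

theory Defs
  imports "HOL-Analysis.Analysis" "HOL-Computational_Algebra.Polynomial"
begin

section \<open>Complex inner product spaces with explicit carrier\<close>

text \<open>The space \<open>P\<^sup>2(\<nu>\<^sub>p)\<close> depends on the polynomial \<open>p\<close>, so Hilbert spaces are
  modelled as records. Inner products are linear in the first argument.\<close>

record 'a ip_space =
  hcarrier :: "'a set"
  hadd :: "'a \<Rightarrow> 'a \<Rightarrow> 'a"
  hscale :: "complex \<Rightarrow> 'a \<Rightarrow> 'a"
  hinner :: "'a \<Rightarrow> 'a \<Rightarrow> complex"

definition hdiff :: "'a ip_space \<Rightarrow> 'a \<Rightarrow> 'a \<Rightarrow> 'a" where
  "hdiff H x y = hadd H x (hscale H (- 1) y)"

definition hnorm :: "'a ip_space \<Rightarrow> 'a \<Rightarrow> real" where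
  "hnorm H x = sqrt (Re (hinner H x x))"

definition hclosure :: "'a ip_space \<Rightarrow> 'a set \<Rightarrow> 'a set" where
  "hclosure H S = {x \<in> hcarrier H. \<forall>e>0. \<exists>y\<in>S. hnorm H (hdiff H x y) < e}"

definition hsubspace :: "'a ip_space \<Rightarrow> 'a set \<Rightarrow> 'a ip_space" where
  "hsubspace H S = H\<lparr>hcarrier := S\<rparr>"

definition hominus :: "'a ip_space \<Rightarrow> 'a set \<Rightarrow> 'a set" where
  "hominus H N = {x \<in> hcarrier H. \<forall>y\<in>N. hinner H x y = 0}"

definition orth_proj :: "'a ip_space \<Rightarrow> 'a set \<Rightarrow> 'a \<Rightarrow> 'a" where
  "orth_proj H N x = (THE y. y \<in> N \<and> (\<forall>u\<in>N. hinner H (hdiff H x y) u = 0))"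

definition adjoint_op :: "'a ip_space \<Rightarrow> 'b ip_space \<Rightarrow> ('a \<Rightarrow> 'b) \<Rightarrow> 'b \<Rightarrow> 'a" where
  "adjoint_op H K T y =
     (THE x. x \<in> hcarrier H \<and> (\<forall>h\<in>hcarrier H. hinner K (T h) y = hinner H h x))"

definition is_unitary :: "'a ip_space \<Rightarrow> 'b ip_space \<Rightarrow> ('a \<Rightarrow> 'b) \<Rightarrow> bool" where
  "is_unitary H K U \<longleftrightarrow>
     bij_betw U (hcarrier H) (hcarrier K) \<and>
     (\<forall>x\<in>hcarrier H. \<forall>y\<in>hcarrier H. U (hadd H x y) = hadd K (U x) (U y)) \<and>
     (\<forall>c. \<forall>x\<in>hcarrier H. U (hscale H c x) = hscale K c (U x)) \<and>
     (\<forall>x\<in>hcarrier H. \<forall>y\<in>hcarrier H. hinner K (U x) (U y) = hinner H x y)"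

definition wandering_proj :: "'a ip_space \<Rightarrow> ('a \<Rightarrow> 'a) \<Rightarrow> 'a \<Rightarrow> 'a" where
  "wandering_proj H A = orth_proj H (hominus H (A ` hcarrier H))"

definition cross_commutator :: "'a ip_space \<Rightarrow> ('a \<Rightarrow> 'a) \<Rightarrow> ('a \<Rightarrow> 'a) \<Rightarrow> 'a \<Rightarrow> 'a" where
  "cross_commutator H A B x =
     hdiff H (adjoint_op H H A (B x)) (B (adjoint_op H H A x))"

definition defect_op :: "'a ip_space \<Rightarrow> ('a \<Rightarrow> 'a) \<Rightarrow> ('a \<Rightarrow> 'a) \<Rightarrow> 'a \<Rightarrow> 'a" where
  "defect_op H A B x =
     hadd H
       (hdiff H (hdiff H x (A (adjoint_op H H A x))) (B (adjoint_op H H B x)))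
       (A (B (adjoint_op H H A (adjoint_op H H B x))))"


section \<open>Polynomials in two variables\<close>

text \<open>\<open>complex poly poly\<close> is \<open>\<complex>[z][w]\<close>: the coefficient of \<open>z\<^sup>j w\<^sup>k\<close> in \<open>p\<close> is
  \<open>coeff (coeff p k) j\<close>.\<close>

definition bieval :: "complex poly poly \<Rightarrow> complex \<times> complex \<Rightarrow> complex" where
  "bieval p = (\<lambda>(z, w). poly (poly p [:w:]) z)"

definition homog :: "nat \<Rightarrow> complex poly poly set" where
  "homog n = {h. \<exists>c :: nat \<Rightarrow> complex. h = (\<Sum>j\<le>n. monom (monom (c j) j) (n - j))}"


section \<open>The Hardy space of the bidisc\<close>

definition bidisc :: "(complex \<times> complex) set" where
  "bidisc = ball 0 1 \<times> ball 0 1"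

definition has_taylor :: "(complex \<times> complex \<Rightarrow> complex) \<Rightarrow> (nat \<times> nat \<Rightarrow> complex) \<Rightarrow> bool" where
  "has_taylor f a \<longleftrightarrow>
     (\<forall>(z, w)\<in>bidisc. ((\<lambda>(j, k). a (j, k) * z ^ j * w ^ k) has_sum f (z, w)) UNIV)"

definition taylor :: "(complex \<times> complex \<Rightarrow> complex) \<Rightarrow> nat \<times> nat \<Rightarrow> complex" where
  "taylor f = (THE a. has_taylor f a)"

text \<open>Holomorphic functions on the bidisc with square summable Taylor coefficients.\<close>

definition hardy2 :: "(complex \<times> complex \<Rightarrow> complex) ip_space" where
  "hardy2 =
    \<lparr> hcarrier = {f \<in> extensional bidisc.
        \<exists>a. has_taylor f a \<and> (\<lambda>k. (cmod (a k))\<^sup>2) summable_on UNIV},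
      hadd = (\<lambda>f g. \<lambda>x\<in>bidisc. f x + g x),
      hscale = (\<lambda>c f. \<lambda>x\<in>bidisc. c * f x),
      hinner = (\<lambda>f g. \<Sum>\<^sub>\<infinity>k. taylor f k * cnj (taylor g k)) \<rparr>"

definition hardy_poly :: "complex poly poly \<Rightarrow> complex \<times> complex \<Rightarrow> complex" where
  "hardy_poly h = restrict (bieval h) bidisc"

definition principal_submodule ::
    "complex poly poly \<Rightarrow> (complex \<times> complex \<Rightarrow> complex) ip_space" where
  "principal_submodule p =
     hsubspace hardy2 (hclosure hardy2 (range (\<lambda>h. hardy_poly (p * h))))"

definition R_z :: "(complex \<times> complex \<Rightarrow> complex) \<Rightarrow> complex \<times> complex \<Rightarrow> complex" where
  "R_z f = (\<lambda>x\<in>bidisc. fst x * f x)"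

definition R_w :: "(complex \<times> complex \<Rightarrow> complex) \<Rightarrow> complex \<times> complex \<Rightarrow> complex" where
  "R_w f = (\<lambda>x\<in>bidisc. snd x * f x)"


section \<open>The space \<open>L\<^sup>2(M)\<close>\<close>

definition sq_integrable :: "'x measure \<Rightarrow> ('x \<Rightarrow> complex) set" where
  "sq_integrable M = {f \<in> borel_measurable M. integrable M (\<lambda>x. (cmod (f x))\<^sup>2)}"

definition ae_rel :: "'x measure \<Rightarrow> (('x \<Rightarrow> complex) \<times> ('x \<Rightarrow> complex)) set" where
  "ae_rel M = {(f, g). f \<in> sq_integrable M \<and> g \<in> sq_integrable M \<and> (AE x in M. f x = g x)}"

definition l2_class :: "'x measure \<Rightarrow> ('x \<Rightarrow> complex) \<Rightarrow> ('x \<Rightarrow> complex) set" where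
  "l2_class M f = ae_rel M `` {f}"

definition l2_rep :: "('x \<Rightarrow> complex) set \<Rightarrow> 'x \<Rightarrow> complex" where
  "l2_rep X = (SOME f. f \<in> X)"

definition L2 :: "'x measure \<Rightarrow> ('x \<Rightarrow> complex) set ip_space" where
  "L2 M =
    \<lparr> hcarrier = sq_integrable M // ae_rel M,
      hadd = (\<lambda>X Y. l2_class M (\<lambda>x. l2_rep X x + l2_rep Y x)),
      hscale = (\<lambda>c X. l2_class M (\<lambda>x. c * l2_rep X x)),
      hinner = (\<lambda>X Y. \<integral>x. l2_rep X x * cnj (l2_rep Y x) \<partial>M) \<rparr>"


section \<open>The measure \<open>\<nu>\<^sub>p\<close> and the space \<open>P\<^sup>2(\<nu>\<^sub>p)\<close>\<close>

text \<open>Normalized Haar measure on the circle is normalized arc length, and on the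
  torus it is the product of the two circle measures.\<close>

definition circle_haar :: "complex measure" where
  "circle_haar =
     distr (uniform_measure lborel {0..1::real}) (restrict_space borel (sphere 0 1))
       (\<lambda>t. cis (2 * pi * t))"

definition torus_haar :: "(complex \<times> complex) measure" where
  "torus_haar = circle_haar \<Otimes>\<^sub>M circle_haar"

definition torus_norm :: "complex poly poly \<Rightarrow> real" where
  "torus_norm p = sqrt (\<integral>x. (cmod (bieval p x))\<^sup>2 \<partial>torus_haar)"

definition nu :: "complex poly poly \<Rightarrow> (complex \<times> complex) measure" where
  "nu p = density torus_haar (\<lambda>x. ennreal ((cmod (bieval p x))\<^sup>2 / (torus_norm p)\<^sup>2))"

definition nu_poly ::
    "complex poly poly \<Rightarrow> complex poly poly \<Rightarrow> (complex \<times> complex \<Rightarrow> complex) set" where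
  "nu_poly p h = l2_class (nu p) (bieval h)"

definition P2 :: "complex poly poly \<Rightarrow> (complex \<times> complex \<Rightarrow> complex) set ip_space" where
  "P2 p = hsubspace (L2 (nu p)) (hclosure (L2 (nu p)) (range (nu_poly p)))"

definition S_z :: "complex poly poly \<Rightarrow>
    (complex \<times> complex \<Rightarrow> complex) set \<Rightarrow> (complex \<times> complex \<Rightarrow> complex) set" where
  "S_z p X = l2_class (nu p) (\<lambda>x. fst x * l2_rep X x)"

definition S_w :: "complex poly poly \<Rightarrow>
    (complex \<times> complex \<Rightarrow> complex) set \<Rightarrow> (complex \<times> complex \<Rightarrow> complex) set" where
  "S_w p X = l2_class (nu p) (\<lambda>x. snd x * l2_rep X x)"

definition extends_mult_unitary :: "complex poly poly \<Rightarrow>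
    ((complex \<times> complex \<Rightarrow> complex) set \<Rightarrow> (complex \<times> complex \<Rightarrow> complex)) \<Rightarrow> bool" where
  "extends_mult_unitary p U \<longleftrightarrow>
     is_unitary (P2 p) (principal_submodule p) U \<and>
     (\<forall>h. U (nu_poly p h) =
        (\<lambda>x\<in>bidisc. bieval p x / complex_of_real (torus_norm p) * bieval h x))"

end

theory Submission
  imports Defs
begin

text \<open>By Parseval on the torus, \<open>\<parallel>p\<parallel>\<^sup>2 \<langle>h, g\<rangle>\<close> in \<open>L\<^sup>2(\<nu>\<^sub>p)\<close> is the Hardy space inner product
  \<open>\<langle>p h, p g\<rangle>\<close> for polynomials \<open>h\<close> and \<open>g\<close>. So the dense families \<open>h\<close> and \<open>p h / \<parallel>p\<parallel>\<close> have the
  same Gram matrix, and as both spaces are complete this yields the unitary \<open>U\<^sub>p\<close>; it intertwines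
  the multiplications on polynomials, hence everywhere. All operators in (ii) are built from isometries
  and their adjoints (the wandering projection of an isometry \<open>A\<close> is \<open>I - A A\<^sup>*\<close>), and the
  adjoints, which exist by the Riesz representation, are carried along by any intertwining unitary.
  Polynomials of different degree being orthogonal in the Hardy space, the Gram matrix restricted to
  homogeneous polynomials reduces to the sum in (iii). For (iv), if \<open>a < b\<close> then
  \<open>\<parallel>p\<parallel>\<^sup>2 \<langle>p\<^sub>b, p\<^sub>a\<rangle> = \<parallel>p\<^sub>a p\<^sub>b\<parallel>\<^sup>2 \<noteq> 0\<close>.\<close>

section \<open>Hilbert spaces with explicit carrier\<close>

text \<open>\<open>adjoint_op\<close>, \<open>orth_proj\<close> and \<open>taylor\<close> are
  \<open>THE\<close> terms, and classes in \<open>L2\<close> are read through \<open>SOME\<close>.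
  An equation about any of them has content only once existence and uniqueness are known, which is
  why completeness of both spaces is needed and not just their inner products. Completeness serves
  twice: for the adjoints, and for the limits that define the unitary. The elements of the Hardy
  space are functions on the open bidisc, those of P^2(nu_p) are classes on the torus, and boundary
  values are never taken. The only bridge is the common index set of polynomials h. The unitary is
  therefore constructed abstractly from two indexed families, and its values off the polynomials are
  never described. Since (ii) speaks of every U that extends the multiplication, the intertwining
  relations are proved for an arbitrary such U and not only for the constructed one.\<close>

abbreviation hdist :: "'a ip_space \<Rightarrow> 'a \<Rightarrow> 'a \<Rightarrow> real" where
  "hdist H x y \<equiv> hnorm H (hdiff H x y)"

lemma hsubspace_simps [simp]:
  "hcarrier (hsubspace K S) = S" "hadd (hsubspace K S) = hadd K"
  "hscale (hsubspace K S) = hscale K" "hinner (hsubspace K S) = hinner K"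
  "hdiff (hsubspace K S) = hdiff K" "hnorm (hsubspace K S) = hnorm K"
  by (auto simp: hsubspace_def hdiff_def hnorm_def fun_eq_iff)

text \<open>The vector space laws need not be assumed: by \<open>inner_ext\<close> two elements with the
  same inner products are equal.\<close>

locale pre_hilbert =
  fixes H :: "'a ip_space"
  assumes nonempty: "hcarrier H \<noteq> {}"
    and add_closed [simp]: "x \<in> hcarrier H \<Longrightarrow> y \<in> hcarrier H \<Longrightarrow> hadd H x y \<in> hcarrier H"
    and scale_closed [simp]: "x \<in> hcarrier H \<Longrightarrow> hscale H c x \<in> hcarrier H"
    and inner_add_left: "x \<in> hcarrier H \<Longrightarrow> y \<in> hcarrier H \<Longrightarrow> z \<in> hcarrier H \<Longrightarrow>
      hinner H (hadd H x y) z = hinner H x z + hinner H y z"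
    and inner_scale_left: "x \<in> hcarrier H \<Longrightarrow> y \<in> hcarrier H \<Longrightarrow>
      hinner H (hscale H c x) y = c * hinner H x y"
    and inner_commute: "x \<in> hcarrier H \<Longrightarrow> y \<in> hcarrier H \<Longrightarrow>
      hinner H y x = cnj (hinner H x y)"
    and inner_self_nonneg: "x \<in> hcarrier H \<Longrightarrow> 0 \<le> Re (hinner H x x)"
    and inner_ext: "x \<in> hcarrier H \<Longrightarrow> y \<in> hcarrier H \<Longrightarrow>
      hinner H (hdiff H x y) (hdiff H x y) = 0 \<Longrightarrow> x = y"
begin

section \<open>Inner product calculus and the norm\<close>

lemma inner_add_right: "x \<in> hcarrier H \<Longrightarrow> y \<in> hcarrier H \<Longrightarrow> z \<in> hcarrier H \<Longrightarrow>
    hinner H z (hadd H x y) = hinner H z x + hinner H z y"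
  by (metis add_closed complex_cnj_add inner_add_left inner_commute)

lemma inner_scale_right: "x \<in> hcarrier H \<Longrightarrow> y \<in> hcarrier H \<Longrightarrow>
    hinner H y (hscale H c x) = cnj c * hinner H y x"
  by (metis complex_cnj_mult inner_commute inner_scale_left scale_closed)

lemma diff_closed [simp]: "x \<in> hcarrier H \<Longrightarrow> y \<in> hcarrier H \<Longrightarrow> hdiff H x y \<in> hcarrier H"
  by (simp add: hdiff_def)

lemma inner_diff_left: "x \<in> hcarrier H \<Longrightarrow> y \<in> hcarrier H \<Longrightarrow> z \<in> hcarrier H \<Longrightarrow>
    hinner H (hdiff H x y) z = hinner H x z - hinner H y z"
  by (simp add: hdiff_def inner_add_left inner_scale_left)

lemma inner_diff_right: "x \<in> hcarrier H \<Longrightarrow> y \<in> hcarrier H \<Longrightarrow> z \<in> hcarrier H \<Longrightarrow>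
    hinner H z (hdiff H x y) = hinner H z x - hinner H z y"
  by (simp add: hdiff_def inner_add_right inner_scale_right)

lemmas inner_expand = inner_add_left inner_add_right inner_scale_left inner_scale_right
  inner_diff_left inner_diff_right

lemma inner_self_real: "x \<in> hcarrier H \<Longrightarrow> Im (hinner H x x) = 0"
  by (metis complex_cnj_cancel_iff cnj.simps(2) inner_commute neg_equal_zero)

lemma hnorm_nonneg [simp]: "x \<in> hcarrier H \<Longrightarrow> 0 \<le> hnorm H x"
  by (simp add: hnorm_def inner_self_nonneg)

lemma hnorm_sq: "x \<in> hcarrier H \<Longrightarrow> (hnorm H x)\<^sup>2 = Re (hinner H x x)"
  by (simp add: hnorm_def inner_self_nonneg)

lemma inner_self: "x \<in> hcarrier H \<Longrightarrow> hinner H x x = complex_of_real ((hnorm H x)\<^sup>2)"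
  by (simp add: hnorm_sq complex_eq_iff inner_self_real)

text \<open>Testing with u = x - y brings in \<open>inner_ext\<close>. Vector identities such as x -
  z = (x - y) + (y - z) are obtained this way, by expanding both sides against u.\<close>

lemma inner_eqI:
  assumes "x \<in> hcarrier H" "y \<in> hcarrier H" "\<And>u. u \<in> hcarrier H \<Longrightarrow> hinner H x u = hinner H y u"
  shows "x = y"
  using assms by (intro inner_ext) (simp_all add: inner_diff_left)

lemma inner_eqI_right:
  assumes "x \<in> hcarrier H" "y \<in> hcarrier H" "\<And>u. u \<in> hcarrier H \<Longrightarrow> hinner H u x = hinner H u y"
  shows "x = y"
  using assms by (intro inner_ext) (simp_all add: inner_diff_right)

lemma hdist_self [simp]: "x \<in> hcarrier H \<Longrightarrow> hdist H x x = 0"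
  by (simp add: hnorm_def inner_diff_left)

lemma hdist_sq: "x \<in> hcarrier H \<Longrightarrow> y \<in> hcarrier H \<Longrightarrow>
    (hdist H x y)\<^sup>2 = Re (hinner H x x) - 2 * Re (hinner H x y) + Re (hinner H y y)"
  by (simp add: hnorm_sq inner_expand inner_commute[of x y])

lemma hdist_commute: "x \<in> hcarrier H \<Longrightarrow> y \<in> hcarrier H \<Longrightarrow> hdist H x y = hdist H y x"
  by (rule power2_eq_imp_eq) (simp_all add: hdist_sq inner_commute[of x y])

text \<open>Expanding ||x - c y||^2 >= 0 with c = t <x, y> and t real leaves a quadratic in t built
  from the three quantities of the inequality.\<close>

lemma Cauchy_Schwarz:
  assumes x: "x \<in> hcarrier H" and y: "y \<in> hcarrier H"
  shows "cmod (hinner H x y) \<le> hnorm H x * hnorm H y"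
proof -
  define S where "S = (cmod (hinner H x y))\<^sup>2"
  define X where "X = (hnorm H x)\<^sup>2"
  define Y where "Y = (hnorm H y)\<^sup>2"
  have quad: "0 \<le> X - 2 * t * S + t\<^sup>2 * S * Y" for t :: real
  proof -
    define c where "c = complex_of_real t * hinner H x y"
    have "0 \<le> (hdist H x (hscale H c y))\<^sup>2" by simp
    also have "\<dots> = X - 2 * Re (cnj c * hinner H x y) + Re (cnj c * c) * Y"
      using x y by (simp add: hdist_sq inner_expand X_def Y_def hnorm_sq inner_self_real
          inner_commute[of x y] algebra_simps)
    also have "Re (cnj c * hinner H x y) = t * S"
      unfolding S_def cmod_power2 by (simp add: c_def power2_eq_square algebra_simps)
    also have "Re (cnj c * c) = t\<^sup>2 * S"
      unfolding S_def cmod_power2 by (simp add: c_def power2_eq_square algebra_simps)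
    finally show ?thesis by (simp add: algebra_simps)
  qed
  have "S \<le> X * Y"
  proof (cases "Y = 0")
    case True
    have "S = 0"
    proof (rule ccontr)
      assume "S \<noteq> 0"
      \<comment> \<open>For Y = 0 the quadratic is linear in t, and this large t makes it
        negative.\<close>
      then have "X - 2 * ((X + 1) / S) * S = - X - 2" by (simp add: field_simps)
      moreover have "0 \<le> X" by (simp add: X_def)
      ultimately show False using quad[of "(X + 1) / S"] True by simp
    qed
    then show ?thesis using True by simp
  next
    case False
    then have "0 < Y" by (simp add: Y_def)
    \<comment> \<open>t = 1 / Y minimizes the quadratic.\<close>
    then show ?thesis using quad[of "1 / Y"] by (simp add: field_simps power2_eq_square)
  qed
  then have "(cmod (hinner H x y))\<^sup>2 \<le> (hnorm H x * hnorm H y)\<^sup>2"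
    by (simp add: S_def X_def Y_def power_mult_distrib)
  then show ?thesis
    by (rule power2_le_imp_le) (simp add: x y)
qed

lemma hnorm_add_le:
  assumes x: "x \<in> hcarrier H" and y: "y \<in> hcarrier H"
  shows "hnorm H (hadd H x y) \<le> hnorm H x + hnorm H y"
proof (rule power2_le_imp_le)
  have "(hnorm H (hadd H x y))\<^sup>2 = (hnorm H x)\<^sup>2 + (hnorm H y)\<^sup>2 + 2 * Re (hinner H x y)"
    using x y by (simp add: hnorm_sq inner_expand inner_commute[of x y])
  moreover have "Re (hinner H x y) \<le> hnorm H x * hnorm H y"
    using Cauchy_Schwarz[OF x y] complex_Re_le_cmod order_trans by blast
  ultimately show "(hnorm H (hadd H x y))\<^sup>2 \<le> (hnorm H x + hnorm H y)\<^sup>2"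
    by (simp add: power2_sum)
qed (simp add: x y)

lemma hdist_triangle:
  assumes "x \<in> hcarrier H" "y \<in> hcarrier H" "z \<in> hcarrier H"
  shows "hdist H x z \<le> hdist H x y + hdist H y z"
proof -
  have "hdiff H x z = hadd H (hdiff H x y) (hdiff H y z)"
    using assms by (intro inner_eqI) (simp_all add: inner_expand)
  then show ?thesis using hnorm_add_le[of "hdiff H x y" "hdiff H y z"] assms by simp
qed

lemma hdist_add_le:
  assumes "x \<in> hcarrier H" "y \<in> hcarrier H" "u \<in> hcarrier H" "v \<in> hcarrier H"
  shows "hdist H (hadd H x y) (hadd H u v) \<le> hdist H x u + hdist H y v"
proof -
  have "hdiff H (hadd H x y) (hadd H u v) = hadd H (hdiff H x u) (hdiff H y v)"
    using assms by (intro inner_eqI) (simp_all add: inner_expand)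
  then show ?thesis using hnorm_add_le[of "hdiff H x u" "hdiff H y v"] assms by simp
qed

lemma hdist_scale:
  assumes "x \<in> hcarrier H" "y \<in> hcarrier H"
  shows "hdist H (hscale H c x) (hscale H c y) = cmod c * hdist H x y"
proof -
  have "hdiff H (hscale H c x) (hscale H c y) = hscale H c (hdiff H x y)"
    using assms by (intro inner_eqI) (simp_all add: inner_expand algebra_simps)
  moreover have "hnorm H (hscale H c u) = cmod c * hnorm H u" if "u \<in> hcarrier H" for u
  proof (rule power2_eq_imp_eq)
    show "(hnorm H (hscale H c u))\<^sup>2 = (cmod c * hnorm H u)\<^sup>2"
      using that
      by (simp add: hnorm_sq inner_expand inner_self_real power_mult_distrib cmod_power2)
        (simp add: power2_eq_square algebra_simps)
  qed (use that in simp_all)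
  ultimately show ?thesis using assms by simp
qed

section \<open>Limits and closures\<close>

lemma tendsto_inner_left:
  assumes s: "\<And>n. s n \<in> hcarrier H" and x: "x \<in> hcarrier H" and u: "u \<in> hcarrier H"
    and lim: "(\<lambda>n. hdist H (s n) x) \<longlonglongrightarrow> 0"
  shows "(\<lambda>n. hinner H (s n) u) \<longlonglongrightarrow> hinner H x u"
proof (rule LIM_zero_cancel, rule Lim_null_comparison)
  show "(\<lambda>n. hdist H (s n) x * hnorm H u) \<longlonglongrightarrow> 0"
    using tendsto_mult_right[OF lim, of "hnorm H u"] by simp
  show "\<forall>\<^sub>F n in sequentially. norm (hinner H (s n) u - hinner H x u) \<le> hdist H (s n) x * hnorm H u"
    using Cauchy_Schwarz[of "hdiff H (s _) x" u] s x u by (simp add: inner_diff_left)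
qed

lemma tendsto_inner_right:
  assumes "\<And>n. s n \<in> hcarrier H" "x \<in> hcarrier H" "u \<in> hcarrier H"
    and "(\<lambda>n. hdist H (s n) x) \<longlonglongrightarrow> 0"
  shows "(\<lambda>n. hinner H u (s n)) \<longlonglongrightarrow> hinner H u x"
  using tendsto_cnj[OF tendsto_inner_left[OF assms]] assms(1-3)
  by (simp flip: inner_commute)

lemma limit_unique:
  assumes s: "\<And>n. s n \<in> hcarrier H" and x: "x \<in> hcarrier H" and y: "y \<in> hcarrier H"
    and "(\<lambda>n. hdist H (s n) x) \<longlonglongrightarrow> 0" "(\<lambda>n. hdist H (s n) y) \<longlonglongrightarrow> 0"
  shows "x = y"
proof (rule inner_eqI[OF x y])
  fix u assume u: "u \<in> hcarrier H"
  show "hinner H x u = hinner H y u"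
    using LIMSEQ_unique tendsto_inner_left[of s, OF s] assms u by blast
qed

lemma hclosure_sequence:
  assumes "x \<in> hclosure H S" "S \<subseteq> hcarrier H"
  obtains s where "\<And>n. s n \<in> S" "(\<lambda>n. hdist H (s n) x) \<longlonglongrightarrow> 0"
proof -
  have x: "x \<in> hcarrier H" using assms(1) by (simp add: hclosure_def)
  have "\<exists>y. y \<in> S \<and> hdist H x y < inverse (real (Suc n))" for n
  proof -
    have "0 < inverse (real (Suc n))" by simp
    then show ?thesis using assms(1) unfolding hclosure_def by blast
  qed
  then obtain s where s: "\<And>n. s n \<in> S" "\<And>n. hdist H x (s n) < inverse (real (Suc n))"
    by metis
  have "(\<lambda>n. hdist H (s n) x) \<longlonglongrightarrow> 0"
  proof (rule Lim_null_comparison[OF _ LIMSEQ_inverse_real_of_nat])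
    show "\<forall>\<^sub>F n in sequentially. norm (hdist H (s n) x) \<le> inverse (real (Suc n))"
    proof (intro always_eventually allI)
      fix n
      have "s n \<in> hcarrier H" using s assms(2) by blast
      then show "norm (hdist H (s n) x) \<le> inverse (real (Suc n))"
        using s(2)[of n] x hdist_commute[of "s n" x] by simp
    qed
  qed
  with s(1) show thesis by (rule that)
qed

lemma hclosure_superset: "S \<subseteq> hcarrier H \<Longrightarrow> S \<subseteq> hclosure H S"
  by (auto simp: hclosure_def intro!: bexI[where P = "\<lambda>y. hdist H _ y < _"])

text \<open>The \<open>s n\<close> may lie in the closure itself, a late one being replaced by a
  point of S at distance less than e / 2. In this form the lemma also shows that closures inherit
  completeness.\<close>

lemma limit_in_hclosure:
  assumes x: "x \<in> hcarrier H" and S: "S \<subseteq> hcarrier H" and s: "\<And>n. s n \<in> hclosure H S"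
    and lim: "(\<lambda>n. hdist H (s n) x) \<longlonglongrightarrow> 0"
  shows "x \<in> hclosure H S"
  unfolding hclosure_def
proof (intro CollectI conjI x allI impI)
  fix e :: real assume "0 < e"
  then have "\<forall>\<^sub>F n in sequentially. hdist H (s n) x < e / 2"
    using order_tendstoD(2)[OF lim, of "e / 2"] by simp
  then obtain n where n: "hdist H (s n) x < e / 2"
    using eventually_happens'[OF sequentially_bot] by blast
  have "\<exists>y\<in>S. hdist H (s n) y < e / 2"
    using s[of n] half_gt_zero[OF \<open>0 < e\<close>] unfolding hclosure_def by blast
  then obtain y where y: "y \<in> S" "hdist H (s n) y < e / 2" by blast
  have "s n \<in> hcarrier H" using s[of n] by (simp add: hclosure_def)
  then have "hdist H x y < e"
    using hdist_triangle[of x "s n" y] hdist_commute[of x "s n"] n y x S by auto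
  then show "\<exists>y\<in>S. hdist H x y < e" using y(1) by blast
qed

text \<open>The operations are those of H, so the laws are inherited and only stability of the
  closure under sums and multiples is at stake. There approximating sequences are added or scaled
  term by term.\<close>

lemma pre_hilbert_hclosure:
  assumes S: "S \<subseteq> hcarrier H" "S \<noteq> {}"
    and add: "\<And>x y. x \<in> S \<Longrightarrow> y \<in> S \<Longrightarrow> hadd H x y \<in> S"
    and scale: "\<And>x c. x \<in> S \<Longrightarrow> hscale H c x \<in> S"
  shows "pre_hilbert (hsubspace H (hclosure H S))"
proof -
  have sub: "hclosure H S \<subseteq> hcarrier H" by (auto simp: hclosure_def)
  have "hadd H x y \<in> hclosure H S" if x: "x \<in> hclosure H S" and y: "y \<in> hclosure H S" for x y
  proof -
    obtain s where s: "\<And>n. s n \<in> S" "(\<lambda>n. hdist H (s n) x) \<longlonglongrightarrow> 0"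
      using hclosure_sequence[OF x S(1)] by blast
    obtain t where t: "\<And>n. t n \<in> S" "(\<lambda>n. hdist H (t n) y) \<longlonglongrightarrow> 0"
      using hclosure_sequence[OF y S(1)] by blast
    have c: "x \<in> hcarrier H" "y \<in> hcarrier H" "\<And>n. s n \<in> hcarrier H" "\<And>n. t n \<in> hcarrier H"
      using x y sub s t S by auto
    show ?thesis
    proof (rule limit_in_hclosure)
      show "hadd H (s n) (t n) \<in> hclosure H S" for n
        using hclosure_superset[OF S(1)] add s t by blast
      show "(\<lambda>n. hdist H (hadd H (s n) (t n)) (hadd H x y)) \<longlonglongrightarrow> 0"
        by (rule Lim_null_comparison[OF _ tendsto_add_zero[OF s(2) t(2)]])
           (simp add: c hdist_add_le)
    qed (use c S in auto)
  qed
  moreover have "hscale H c x \<in> hclosure H S" if x: "x \<in> hclosure H S" for x c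
  proof -
    obtain s where s: "\<And>n. s n \<in> S" "(\<lambda>n. hdist H (s n) x) \<longlonglongrightarrow> 0"
      using hclosure_sequence[OF x S(1)] by blast
    have c: "x \<in> hcarrier H" "\<And>n. s n \<in> hcarrier H"
      using x sub s S by auto
    show ?thesis
    proof (rule limit_in_hclosure)
      show "hscale H c (s n) \<in> hclosure H S" for n
        using hclosure_superset[OF S(1)] scale s by blast
      show "(\<lambda>n. hdist H (hscale H c (s n)) (hscale H c x)) \<longlonglongrightarrow> 0"
        using tendsto_mult_right_zero[OF s(2)] by (simp add: c hdist_scale)
    qed (use c S in auto)
  qed
  moreover have "hclosure H S \<noteq> {}" using hclosure_superset S by blast
  ultimately show ?thesis
    by unfold_locales
      (use sub in \<open>auto simp: subset_iff inner_expand inner_self_nonneg intro: inner_commute inner_ext\<close>)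
qed

end

section \<open>Completeness and the Riesz representation\<close>

definition hcomplete :: "'a ip_space \<Rightarrow> bool" where
  "hcomplete H \<longleftrightarrow> (\<forall>s :: nat \<Rightarrow> 'a. (\<forall>n. s n \<in> hcarrier H) \<longrightarrow>
     (\<forall>e>0. \<exists>N. \<forall>m\<ge>N. \<forall>n\<ge>N. hdist H (s m) (s n) < e) \<longrightarrow>
     (\<exists>x\<in>hcarrier H. (\<lambda>n. hdist H (s n) x) \<longlonglongrightarrow> 0))"

locale hilbert = pre_hilbert +
  assumes complete: "hcomplete H"
begin

lemma hilbert_hclosure:
  assumes "S \<subseteq> hcarrier H" "S \<noteq> {}"
    and "\<And>x y. x \<in> S \<Longrightarrow> y \<in> S \<Longrightarrow> hadd H x y \<in> S"
    and "\<And>x c. x \<in> S \<Longrightarrow> hscale H c x \<in> S"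
  shows "hilbert (hsubspace H (hclosure H S))"
proof -
  have "hcomplete (hsubspace H (hclosure H S))"
    unfolding hcomplete_def
  proof (intro allI impI, simp only: hsubspace_simps)
    fix s :: "nat \<Rightarrow> 'a" assume s: "\<forall>n. s n \<in> hclosure H S"
      and cauchy: "\<forall>e>0. \<exists>N. \<forall>m\<ge>N. \<forall>n\<ge>N. hdist H (s m) (s n) < e"
    have "\<forall>n. s n \<in> hcarrier H" using s by (simp add: hclosure_def)
    then obtain x where "x \<in> hcarrier H" "(\<lambda>n. hdist H (s n) x) \<longlonglongrightarrow> 0"
      using complete cauchy unfolding hcomplete_def by blast
    then show "\<exists>x\<in>hclosure H S. (\<lambda>n. hdist H (s n) x) \<longlonglongrightarrow> 0"
      using limit_in_hclosure s assms(1) by blast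
  qed
  then show ?thesis
    using pre_hilbert_hclosure[OF assms] by (simp add: hilbert_def hilbert_axioms_def)
qed

text \<open>The representing vector minimizes \<open>Q h = \<parallel>h\<parallel>\<^sup>2 - 2 Re (\<phi> h)\<close>.\<close>

lemma Riesz_representation:
  assumes add: "\<And>x y. x \<in> hcarrier H \<Longrightarrow> y \<in> hcarrier H \<Longrightarrow> \<phi> (hadd H x y) = \<phi> x + \<phi> y"
    and scale: "\<And>c x. x \<in> hcarrier H \<Longrightarrow> \<phi> (hscale H c x) = c * \<phi> x"
    and bound: "\<And>x. x \<in> hcarrier H \<Longrightarrow> cmod (\<phi> x) \<le> C * hnorm H x"
  obtains x where "x \<in> hcarrier H" "\<And>h. h \<in> hcarrier H \<Longrightarrow> \<phi> h = hinner H h x"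
proof -
  define Q where "Q h = (hnorm H h)\<^sup>2 - 2 * Re (\<phi> h)" for h
  define \<delta> where "\<delta> = (INF h\<in>hcarrier H. Q h)"
  have "- C\<^sup>2 \<le> Q h" if "h \<in> hcarrier H" for h
  proof -
    have "Re (\<phi> h) \<le> C * hnorm H h" using bound[OF that] complex_Re_le_cmod order_trans by blast
    moreover have "0 \<le> (hnorm H h - C)\<^sup>2" by simp
    ultimately show ?thesis by (simp add: Q_def power2_diff algebra_simps)
  qed
  then have bdd: "bdd_below (Q ` hcarrier H)" by (auto intro!: bdd_belowI)
  have lower: "\<delta> \<le> Q h" if "h \<in> hcarrier H" for h
    unfolding \<delta>_def using bdd that by (rule cINF_lower)
  have "\<exists>h. h \<in> hcarrier H \<and> Q h < \<delta> + inverse (real (Suc n))" for n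
  proof -
    have "(INF h\<in>hcarrier H. Q h) < \<delta> + inverse (real (Suc n))" by (simp add: \<delta>_def)
    then show ?thesis using cINF_less_iff[OF nonempty bdd] by blast
  qed
  then obtain s where s: "\<And>n. s n \<in> hcarrier H" "\<And>n. Q (s n) < \<delta> + inverse (real (Suc n))"
    by metis
  have Qlim: "(\<lambda>n. Q (s n)) \<longlonglongrightarrow> \<delta>"
  proof (rule tendsto_sandwich[of "\<lambda>_. \<delta>" _ _ "\<lambda>n. \<delta> + inverse (real (Suc n))"])
    show "(\<lambda>n. \<delta> + inverse (real (Suc n))) \<longlonglongrightarrow> \<delta>"
      using tendsto_add[OF tendsto_const LIMSEQ_inverse_real_of_nat] by simp
  qed (use lower s in \<open>auto intro!: always_eventually less_imp_le simp del: of_nat_Suc\<close>)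
  \<comment> \<open>The linear terms cancel in 2 Q x + 2 Q y - 4 Q ((x + y) / 2), which therefore
    equals ||x - y||^2. So nearly minimal points are close together.\<close>
  have parallelogram: "(hdist H x y)\<^sup>2 \<le> 2 * Q x + 2 * Q y - 4 * \<delta>"
    if "x \<in> hcarrier H" "y \<in> hcarrier H" for x y
  proof -
    have "\<delta> \<le> Q (hscale H (1/2) (hadd H x y))" using that by (intro lower) simp
    also have "\<dots> = ((hnorm H x)\<^sup>2 + (hnorm H y)\<^sup>2 + 2 * Re (hinner H x y)) / 4 - Re (\<phi> x) - Re (\<phi> y)"
      using that by (simp add: Q_def hnorm_sq inner_expand add scale inner_commute[of x y] field_simps)
    finally show ?thesis
      unfolding hdist_sq[OF that] using that by (simp add: Q_def hnorm_sq field_simps)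
  qed
  have "\<exists>N. \<forall>m\<ge>N. \<forall>n\<ge>N. hdist H (s m) (s n) < e" if "0 < e" for e
  proof -
    have "\<forall>\<^sub>F n in sequentially. Q (s n) < \<delta> + e\<^sup>2 / 4"
      using order_tendstoD(2)[OF Qlim, of "\<delta> + e\<^sup>2 / 4"] that by simp
    \<comment> \<open>With both values of Q below \<delta> + e^2 / 4 the parallelogram bound is
      below e^2.\<close>
    then obtain N where N: "\<And>n. n \<ge> N \<Longrightarrow> Q (s n) < \<delta> + e\<^sup>2 / 4"
      by (auto simp: eventually_sequentially)
    have "hdist H (s m) (s n) < e" if "m \<ge> N" "n \<ge> N" for m n
    proof (rule power2_less_imp_less)
      show "(hdist H (s m) (s n))\<^sup>2 < e\<^sup>2"
        using parallelogram[OF s(1)[of m] s(1)[of n]] N[OF that(1)] N[OF that(2)] by simp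
    qed (use \<open>0 < e\<close> in simp)
    then show ?thesis by blast
  qed
  then obtain x where x: "x \<in> hcarrier H" "(\<lambda>n. hdist H (s n) x) \<longlonglongrightarrow> 0"
    using complete s(1) unfolding hcomplete_def by blast
  have "\<phi> u = hinner H u x" if u: "u \<in> hcarrier H" for u
  proof -
    define w where "w = hinner H u x - \<phi> u"
    \<comment> \<open>First variation of Q in the direction c u. It is taken at the points
      \<open>s n\<close>, where Q tends to its infimum, and then passed to the limit.\<close>
    have quad: "0 \<le> (cmod c)\<^sup>2 * (hnorm H u)\<^sup>2 + 2 * Re (c * w)" for c
    proof -
      have "\<delta> \<le> Q (s n) + (cmod c)\<^sup>2 * (hnorm H u)\<^sup>2 + 2 * Re (c * (hinner H u (s n) - \<phi> u))" for n
      proof -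
        have "\<delta> \<le> Q (hadd H (s n) (hscale H c u))" using u s(1) by (intro lower) simp
        also have "\<dots> = Q (s n) + Re (c * cnj c) * (hnorm H u)\<^sup>2
            + 2 * Re (c * (hinner H u (s n) - \<phi> u))"
          using u s(1) by (simp add: Q_def hnorm_sq inner_expand add scale
              inner_commute[of u "s n"] inner_self_real algebra_simps)
        finally show ?thesis unfolding cmod_power2 by (simp add: power2_eq_square)
      qed
      moreover have "(\<lambda>n. Q (s n) + (cmod c)\<^sup>2 * (hnorm H u)\<^sup>2 + 2 * Re (c * (hinner H u (s n) - \<phi> u)))
          \<longlonglongrightarrow> \<delta> + (cmod c)\<^sup>2 * (hnorm H u)\<^sup>2 + 2 * Re (c * (hinner H u x - \<phi> u))"
        by (intro tendsto_intros Qlim tendsto_inner_right s x u)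
      ultimately have "\<delta> \<le> \<delta> + (cmod c)\<^sup>2 * (hnorm H u)\<^sup>2 + 2 * Re (c * (hinner H u x - \<phi> u))"
        by (intro LIMSEQ_le_const) auto
      then show ?thesis by (simp add: w_def)
    qed
    have "w = 0"
    proof (rule ccontr)
      assume "w \<noteq> 0"
      \<comment> \<open>With c = - t * cnj w the bound becomes t |w|^2 (t ||u||^2 - 2), which is
        negative as soon as t ||u||^2 <= 1; the + 1 covers ||u|| = 0.\<close>
      define t where "t = inverse ((hnorm H u)\<^sup>2 + 1)"
      have "0 < (hnorm H u)\<^sup>2 + 1" by (simp add: add_nonneg_pos)
      then have t: "0 < t" "t * (hnorm H u)\<^sup>2 \<le> 1" by (auto simp: t_def field_simps)
      have "0 \<le> (t * cmod w)\<^sup>2 * (hnorm H u)\<^sup>2 - 2 * t * (cmod w)\<^sup>2"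
      proof -
        have "Re (- (complex_of_real t * cnj w) * w) = - (t * (cmod w)\<^sup>2)"
          unfolding cmod_power2 by (simp add: power2_eq_square algebra_simps)
        then show ?thesis
          using quad[of "- (complex_of_real t * cnj w)"] t by (simp add: norm_mult)
      qed
      also have "\<dots> = t * (cmod w)\<^sup>2 * (t * (hnorm H u)\<^sup>2 - 2)"
        by (simp add: power2_eq_square algebra_simps)
      also have "\<dots> < 0"
        using t \<open>w \<noteq> 0\<close> by (intro mult_pos_neg) simp_all
      finally show False by simp
    qed
    then show ?thesis by (simp add: w_def)
  qed
  with x(1) show thesis by (rule that)
qed

end

section \<open>Isometries, their adjoints and wandering projections\<close>

definition isometry_on :: "'a ip_space \<Rightarrow> ('a \<Rightarrow> 'a) \<Rightarrow> bool" where
  "isometry_on H A \<longleftrightarrow>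
     (\<forall>x\<in>hcarrier H. A x \<in> hcarrier H) \<and>
     (\<forall>x\<in>hcarrier H. \<forall>y\<in>hcarrier H. A (hadd H x y) = hadd H (A x) (A y)) \<and>
     (\<forall>c. \<forall>x\<in>hcarrier H. A (hscale H c x) = hscale H c (A x)) \<and>
     (\<forall>x\<in>hcarrier H. \<forall>y\<in>hcarrier H. hinner H (A x) (A y) = hinner H x y)"

lemma isometry_onD:
  assumes "isometry_on H A"
  shows "x \<in> hcarrier H \<Longrightarrow> A x \<in> hcarrier H"
    and "x \<in> hcarrier H \<Longrightarrow> y \<in> hcarrier H \<Longrightarrow> A (hadd H x y) = hadd H (A x) (A y)"
    and "x \<in> hcarrier H \<Longrightarrow> A (hscale H c x) = hscale H c (A x)"
    and "x \<in> hcarrier H \<Longrightarrow> y \<in> hcarrier H \<Longrightarrow> hinner H (A x) (A y) = hinner H x y"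
  using assms by (auto simp: isometry_on_def)

text \<open>An isometry preserves distances, so it carries a sequence approximating x to one
  approximating \<open>A x\<close>. This is how multiplication by a coordinate restricts to the
  closure of an invariant family of polynomials.\<close>

lemma (in pre_hilbert) isometry_on_hclosure:
  assumes A: "isometry_on H A" and S: "S \<subseteq> hcarrier H" and inv: "\<And>x. x \<in> S \<Longrightarrow> A x \<in> S"
  shows "isometry_on (hsubspace H (hclosure H S)) A"
proof -
  note iso = isometry_onD[OF A]
  have "A x \<in> hclosure H S" if x: "x \<in> hclosure H S" for x
  proof -
    obtain s where s: "\<And>n. s n \<in> S" "(\<lambda>n. hdist H (s n) x) \<longlonglongrightarrow> 0"
      using hclosure_sequence[OF x S] by blast
    have c: "x \<in> hcarrier H" "\<And>n. s n \<in> hcarrier H"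
      using x s S by (auto simp: hclosure_def)
    have dist: "hdist H (A (s n)) (A x) = hdist H (s n) x" for n
      by (rule power2_eq_imp_eq) (simp_all add: hdist_sq c iso)
    show ?thesis
      by (rule limit_in_hclosure[of _ S "\<lambda>n. A (s n)"])
        (use c s S inv hclosure_superset[OF S] in \<open>auto simp: iso dist\<close>)
  qed
  moreover have "hclosure H S \<subseteq> hcarrier H" by (auto simp: hclosure_def)
  ultimately show ?thesis using A by (auto simp: isometry_on_def subset_iff)
qed

text \<open>One witness evaluates the \<open>THE\<close> term, as two representing vectors have the
  same inner product with every h.\<close>

lemma (in pre_hilbert) adjoint_op_eqI:
  assumes "x \<in> hcarrier H" "\<And>h. h \<in> hcarrier H \<Longrightarrow> hinner K (T h) y = hinner H h x"
  shows "adjoint_op H K T y = x"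
  unfolding adjoint_op_def using assms by (intro the_equality) (auto intro: inner_eqI_right)

context hilbert
begin

text \<open>Riesz representation of the functional h -> <A h, y>, bounded by ||y|| because ||A h|| =
  ||h||.\<close>

lemma adjoint_isometry:
  assumes A: "isometry_on H A" and y: "y \<in> hcarrier H"
  shows adjoint_closed: "adjoint_op H H A y \<in> hcarrier H"
    and inner_adjoint: "h \<in> hcarrier H \<Longrightarrow> hinner H (A h) y = hinner H h (adjoint_op H H A y)"
proof -
  note iso = isometry_onD[OF A]
  obtain x where x: "x \<in> hcarrier H" "\<And>h. h \<in> hcarrier H \<Longrightarrow> hinner H (A h) y = hinner H h x"
  proof (rule Riesz_representation[of "\<lambda>h. hinner H (A h) y" "hnorm H y"])
    fix h assume h: "h \<in> hcarrier H"
    then have "hnorm H (A h) = hnorm H h" by (simp add: hnorm_def iso)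
    then show "cmod (hinner H (A h) y) \<le> hnorm H y * hnorm H h"
      using Cauchy_Schwarz[of "A h" y] h y iso by (simp add: mult.commute)
  qed (auto simp: iso y inner_expand)
  then have "adjoint_op H H A y = x" by (rule adjoint_op_eqI)
  with x show "adjoint_op H H A y \<in> hcarrier H"
    "h \<in> hcarrier H \<Longrightarrow> hinner H (A h) y = hinner H h (adjoint_op H H A y)" by simp_all
qed

text \<open>The vector \<open>z\<close> lies in the range of A, and <A h, z> = <A h, x> for all h
  because A is isometric. It is thus the projection of x to the range, and x - z is the projection
  to the complement.\<close>

lemma wandering_proj_isometry:
  assumes A: "isometry_on H A" and x: "x \<in> hcarrier H"
  shows "wandering_proj H A x = hdiff H x (A (adjoint_op H H A x))"
proof -
  note iso = isometry_onD[OF A]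
  define z where "z = A (adjoint_op H H A x)"
  define N where "N = hominus H (A ` hcarrier H)"
  have a: "adjoint_op H H A x \<in> hcarrier H" by (rule adjoint_closed[OF A x])
  then have z: "z \<in> hcarrier H" by (simp add: z_def iso)
  have N: "u \<in> N \<longleftrightarrow> u \<in> hcarrier H \<and> (\<forall>h\<in>hcarrier H. hinner H u (A h) = 0)" for u
    by (auto simp: N_def hominus_def)
  have xz: "hdiff H x z \<in> N"
  proof -
    have "hinner H (A h) (hdiff H x z) = 0" if "h \<in> hcarrier H" for h
    proof -
      have "hinner H (A h) z = hinner H (A h) x"
        using that a by (simp add: z_def iso(4) inner_adjoint[OF A x])
      then show ?thesis using that x z by (simp add: inner_diff_right iso(1))
    qed
    then show ?thesis using x z iso by (simp add: N inner_commute[of "A _" "hdiff H x z"])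
  qed
  have orth: "hinner H (hdiff H x (hdiff H x z)) u = 0" if "u \<in> N" for u
  proof -
    have u: "u \<in> hcarrier H" "hinner H u z = 0" using that a by (auto simp: N z_def)
    then show ?thesis using x z inner_commute[of u z] by (simp add: inner_diff_left)
  qed
  have "orth_proj H N x = hdiff H x z"
    unfolding orth_proj_def
  proof (rule the_equality)
    fix y assume y: "y \<in> N \<and> (\<forall>u\<in>N. hinner H (hdiff H x y) u = 0)"
    \<comment> \<open>Two candidates for the projection differ by a vector of N that is orthogonal
      to N, hence to itself.\<close>
    define d where "d = hdiff H y (hdiff H x z)"
    have c: "y \<in> hcarrier H" "hdiff H x z \<in> hcarrier H" using y xz by (auto simp: N)
    then have "d \<in> N" using y xz iso by (simp add: d_def N inner_diff_left)
    then have "hinner H (hdiff H x y) d = 0" "hinner H (hdiff H x (hdiff H x z)) d = 0"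
      "d \<in> hcarrier H"
      using y orth by (auto simp: N)
    then have "hinner H d d = 0" using x c by (simp add: d_def inner_diff_left)
    then show "y = hdiff H x z" using c unfolding d_def by (intro inner_ext)
  qed (use xz orth in blast)
  then show ?thesis by (simp add: wandering_proj_def N_def z_def)
qed

end

section \<open>Transport of operators along a unitary\<close>

lemma is_unitaryD:
  assumes "is_unitary H K U"
  shows "x \<in> hcarrier H \<Longrightarrow> U x \<in> hcarrier K"
    and "x \<in> hcarrier H \<Longrightarrow> y \<in> hcarrier H \<Longrightarrow> U (hadd H x y) = hadd K (U x) (U y)"
    and "x \<in> hcarrier H \<Longrightarrow> U (hscale H c x) = hscale K c (U x)"
    and "x \<in> hcarrier H \<Longrightarrow> y \<in> hcarrier H \<Longrightarrow> hinner K (U x) (U y) = hinner H x y"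
    and "U ` hcarrier H = hcarrier K"
  using assms by (auto simp: is_unitary_def bij_betw_def)

locale unitary_pair = H: hilbert H + K: hilbert K
  for H :: "'a ip_space" and K :: "'b ip_space" and U :: "'a \<Rightarrow> 'b" +
  assumes unitary: "is_unitary H K U"
begin

lemmas U = is_unitaryD[OF unitary]

lemma U_diff: "x \<in> hcarrier H \<Longrightarrow> y \<in> hcarrier H \<Longrightarrow> U (hdiff H x y) = hdiff K (U x) (U y)"
  by (simp add: hdiff_def U)

text \<open>All that has to be known of the adjoint of U: in the conjugation formulas it is only
  applied to vectors that can be brought to the form \<open>U y\<close>.\<close>

lemma adjoint_U: "y \<in> hcarrier H \<Longrightarrow> adjoint_op H K U (U y) = y"
  by (rule H.adjoint_op_eqI) (simp_all add: U)

text \<open>Every vector of K is some \<open>U h\<close>, and <B U h, U x> = <U A h, U x> = <A h, x>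
  = <h, A^* x> = <U h, U A^* x>.\<close>

lemma U_adjoint:
  assumes A: "isometry_on H A" and AB: "\<And>x. x \<in> hcarrier H \<Longrightarrow> U (A x) = B (U x)"
    and x: "x \<in> hcarrier H"
  shows "adjoint_op K K B (U x) = U (adjoint_op H H A x)"
proof (rule K.adjoint_op_eqI)
  show "U (adjoint_op H H A x) \<in> hcarrier K" by (simp add: U H.adjoint_closed[OF A x])
next
  fix k assume "k \<in> hcarrier K"
  then obtain h where h: "h \<in> hcarrier H" "k = U h" using U(5) by blast
  then show "hinner K (B k) (U x) = hinner K k (U (adjoint_op H H A x))"
    using x isometry_onD(1)[OF A]
    by (simp add: AB[symmetric] U H.adjoint_closed[OF A x] H.inner_adjoint[OF A x])
qed

context
  fixes A B A' B'
  assumes isoA: "isometry_on H A" and isoB: "isometry_on H B"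
    and isoA': "isometry_on K A'" and isoB': "isometry_on K B'"
    and UA: "\<And>x. x \<in> hcarrier H \<Longrightarrow> U (A x) = A' (U x)"
    and UB: "\<And>x. x \<in> hcarrier H \<Longrightarrow> U (B x) = B' (U x)"
begin

lemmas closed = isometry_onD(1)[OF isoA] isometry_onD(1)[OF isoB]
  H.adjoint_closed[OF isoA] H.adjoint_closed[OF isoB]

text \<open>Oriented so that \<open>simp\<close> pulls U outwards through every operation, until
  \<open>adjoint_U\<close> cancels it.\<close>

lemmas moves = UA[symmetric] UB[symmetric] U_diff[symmetric] U(2)[symmetric]
  U_adjoint[OF isoA UA] U_adjoint[OF isoB UB]

lemma conj_wandering_proj:
  "x \<in> hcarrier H \<Longrightarrow> adjoint_op H K U (wandering_proj K A' (U x)) = wandering_proj H A x"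
  by (simp add: K.wandering_proj_isometry[OF isoA'] H.wandering_proj_isometry[OF isoA]
      U(1) closed moves adjoint_U)

lemma conj_cross_commutator:
  "x \<in> hcarrier H \<Longrightarrow>
    adjoint_op H K U (cross_commutator K A' B' (U x)) = cross_commutator H A B x"
  by (simp add: cross_commutator_def closed moves adjoint_U)

lemma conj_defect_op:
  "x \<in> hcarrier H \<Longrightarrow> adjoint_op H K U (defect_op K A' B' (U x)) = defect_op H A B x"
  by (simp add: defect_op_def closed moves adjoint_U)

end

text \<open>U A and B U both preserve distances and agree on S. Along a sequence of S approximating
  x their common values converge to \<open>U (A x)\<close> and to \<open>B (U x)\<close>, and limits
  are unique.\<close>

lemma intertwine_dense:
  assumes A: "isometry_on H A" and B: "isometry_on K B"
    and S: "S \<subseteq> hcarrier H" "hclosure H S = hcarrier H"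
    and AB: "\<And>x. x \<in> S \<Longrightarrow> U (A x) = B (U x)" and x: "x \<in> hcarrier H"
  shows "U (A x) = B (U x)"
proof -
  have Bdist: "hdist K (B u) (B v) = hdist K u v" if "u \<in> hcarrier K" "v \<in> hcarrier K" for u v
    by (rule power2_eq_imp_eq) (use that isometry_onD[OF B] in \<open>simp_all add: K.hdist_sq\<close>)
  have Adist: "hdist H (A u) (A v) = hdist H u v" if "u \<in> hcarrier H" "v \<in> hcarrier H" for u v
    by (rule power2_eq_imp_eq) (use that isometry_onD[OF A] in \<open>simp_all add: H.hdist_sq\<close>)
  have Udist: "hdist K (U u) (U v) = hdist H u v" if "u \<in> hcarrier H" "v \<in> hcarrier H" for u v
    by (rule power2_eq_imp_eq) (use that U in \<open>simp_all add: K.hdist_sq H.hdist_sq\<close>)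
  obtain s where s: "\<And>n. s n \<in> S" "(\<lambda>n. hdist H (s n) x) \<longlonglongrightarrow> 0"
    using H.hclosure_sequence[of x S] S x by auto
  have c: "\<And>n. s n \<in> hcarrier H" using s S by blast
  note cl = c x isometry_onD(1)[OF A] isometry_onD(1)[OF B] U(1)
  have "(\<lambda>n. hdist K (U (A (s n))) (U (A x))) \<longlonglongrightarrow> 0"
    using s(2) by (simp add: Udist Adist cl)
  moreover have "(\<lambda>n. hdist K (U (A (s n))) (B (U x))) \<longlonglongrightarrow> 0"
    using s by (simp add: AB Bdist Udist cl)
  ultimately show ?thesis by (rule K.limit_unique[rotated 3]) (simp_all add: cl)
qed

end

section \<open>Unitaries from families with equal Gram matrices\<close>

lemma (in hilbert) eq_if_inner_dense:
  assumes w: "range w \<subseteq> hcarrier H" "hclosure H (range w) = hcarrier H"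
    and x: "x \<in> hcarrier H" and x': "x' \<in> hcarrier H"
    and eq: "\<And>i. hinner H x (w i) = hinner H x' (w i)"
  shows "x = x'"
proof (rule inner_eqI[OF x x'])
  fix z assume z: "z \<in> hcarrier H"
  obtain s where s: "\<And>n. s n \<in> range w" "(\<lambda>n. hdist H (s n) z) \<longlonglongrightarrow> 0"
    using hclosure_sequence[of z "range w"] w z by blast
  have c: "\<And>n. s n \<in> hcarrier H" using s w by blast
  have "hinner H x (s n) = hinner H x' (s n)" for n
    using s(1)[of n] eq by auto
  then show "hinner H x z = hinner H x' z"
    using tendsto_inner_right[OF c z x s(2)] tendsto_inner_right[OF c z x' s(2)]
    by (simp add: LIMSEQ_unique)
qed

text \<open>Squared distances within a family are combinations of Gram entries, so the passage from
  \<open>u j\<close> to \<open>v j\<close> preserves distances, and indices approximating x give a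
  Cauchy sequence in K. The indices are returned because an inner product of limits is later
  computed along them.\<close>

lemma transfer_limit:
  assumes "hilbert H" "hilbert K"
    and u: "\<And>i. u i \<in> hcarrier H" and v: "\<And>i. v i \<in> hcarrier K"
    and gram: "\<And>i j. hinner H (u i) (u j) = hinner K (v i) (v j)"
    and x: "x \<in> hclosure H (range u)"
  obtains y i where "y \<in> hcarrier K" "(\<lambda>n. hdist H (u (i n)) x) \<longlonglongrightarrow> 0"
    "(\<lambda>n. hdist K (v (i n)) y) \<longlonglongrightarrow> 0" "\<And>j. hinner H x (u j) = hinner K y (v j)"
proof -
  interpret H: hilbert H by fact
  interpret K: hilbert K by fact
  have xH: "x \<in> hcarrier H" using x by (simp add: hclosure_def)
  obtain s where s: "\<And>n. s n \<in> range u" "(\<lambda>n. hdist H (s n) x) \<longlonglongrightarrow> 0"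
    using H.hclosure_sequence[OF x] u by blast
  then have "\<exists>i. \<forall>n. s n = u (i n)" by (metis rangeE)
  then obtain i where si: "\<And>n. s n = u (i n)" by blast
  note lim = s(2)[unfolded si]
  have dist: "hdist K (v j) (v k) = hdist H (u j) (u k)" for j k
    by (rule power2_eq_imp_eq) (simp_all add: H.hdist_sq K.hdist_sq u v gram)
  have "\<exists>N. \<forall>m\<ge>N. \<forall>n\<ge>N. hdist K (v (i m)) (v (i n)) < e" if e: "0 < e" for e
  proof -
    obtain N where N: "\<And>n. n \<ge> N \<Longrightarrow> hdist H (u (i n)) x < e / 2"
      using order_tendstoD(2)[OF lim, of "e / 2"] e by (auto simp: eventually_sequentially)
    have "hdist H (u (i m)) (u (i n)) < e" if "m \<ge> N" "n \<ge> N" for m n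
      using H.hdist_triangle[of "u (i m)" x "u (i n)"] H.hdist_commute[of x "u (i n)"]
        N[OF that(1)] N[OF that(2)] xH u by simp
    then show ?thesis unfolding dist by blast
  qed
  then have "\<exists>y\<in>hcarrier K. (\<lambda>n. hdist K (v (i n)) y) \<longlonglongrightarrow> 0"
    using K.complete[unfolded hcomplete_def, rule_format, of "\<lambda>n. v (i n)"] v by blast
  then obtain y where y: "y \<in> hcarrier K" "(\<lambda>n. hdist K (v (i n)) y) \<longlonglongrightarrow> 0" by blast
  have "hinner H x (u j) = hinner K y (v j)" for j
  proof (rule LIMSEQ_unique)
    show "(\<lambda>n. hinner H (u (i n)) (u j)) \<longlonglongrightarrow> hinner H x (u j)"
      by (rule H.tendsto_inner_left[OF _ xH _ lim]) (simp_all add: u)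
    show "(\<lambda>n. hinner H (u (i n)) (u j)) \<longlonglongrightarrow> hinner K y (v j)"
      unfolding gram by (rule K.tendsto_inner_left[OF _ y(1) _ y(2)]) (simp_all add: v)
  qed
  with y lim show thesis using that by blast
qed

text \<open>\<open>x\<close> and \<open>y\<close> correspond when \<open>\<langle>x, u i\<rangle> = \<langle>y, v i\<rangle>\<close> for all \<open>i\<close>; this relation is linear and,
  by density, one-to-one without any choice of approximating sequences.\<close>

lemma unitary_extension:
  fixes u :: "'i \<Rightarrow> 'a" and v :: "'i \<Rightarrow> 'b"
  assumes "hilbert H" "hilbert K"
    and u: "range u \<subseteq> hcarrier H" "hclosure H (range u) = hcarrier H"
    and v: "range v \<subseteq> hcarrier K" "hclosure K (range v) = hcarrier K"
    and gram: "\<And>i j. hinner H (u i) (u j) = hinner K (v i) (v j)"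
  obtains U where "is_unitary H K U" "\<And>i. U (u i) = v i"
proof -
  interpret H: hilbert H by fact
  interpret K: hilbert K by fact
  define R where "R x y \<longleftrightarrow> x \<in> hcarrier H \<and> y \<in> hcarrier K \<and>
    (\<forall>i. hinner H x (u i) = hinner K y (v i))" for x y
  have uH: "\<And>i. u i \<in> hcarrier H" and vK: "\<And>i. v i \<in> hcarrier K" using u v by auto
  have R_right: "y = y'" if "R x y" "R x y'" for x y y'
    using that K.eq_if_inner_dense[OF v, of y y'] by (simp add: R_def)
  have R_left: "x = x'" if "R x y" "R x' y" for x x' y
    using that H.eq_if_inner_dense[OF u, of x x'] by (simp add: R_def)
  have total: "\<exists>y i. R x y \<and> (\<lambda>n. hdist H (u (i n)) x) \<longlonglongrightarrow> 0 \<and> (\<lambda>n. hdist K (v (i n)) y) \<longlonglongrightarrow> 0"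
    if "x \<in> hcarrier H" for x
  proof -
    have x: "x \<in> hclosure H (range u)" using that u by simp
    obtain y i where "y \<in> hcarrier K" "(\<lambda>n. hdist H (u (i n)) x) \<longlonglongrightarrow> 0"
      "(\<lambda>n. hdist K (v (i n)) y) \<longlonglongrightarrow> 0" "\<And>j. hinner H x (u j) = hinner K y (v j)"
      by (rule transfer_limit[OF \<open>hilbert H\<close> \<open>hilbert K\<close> uH vK gram x]) blast
    with that show ?thesis unfolding R_def by (intro exI[of _ y] exI[of _ i]) simp
  qed
  \<comment> \<open>The hypotheses are symmetric in the two families, so the transfer also runs from
    K to H.\<close>
  have surj: "\<exists>x. R x y" if "y \<in> hcarrier K" for y
  proof -
    have y: "y \<in> hclosure K (range v)" using that v by simp
    obtain x where "x \<in> hcarrier H" "\<And>j. hinner K y (v j) = hinner H x (u j)"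
      using transfer_limit[OF \<open>hilbert K\<close> \<open>hilbert H\<close> vK uH gram[symmetric] y] by blast
    then show ?thesis using that by (auto simp: R_def)
  qed
  define U where "U x = (THE y. R x y)" for x
  have RU: "R x (U x)" if "x \<in> hcarrier H" for x
    unfolding U_def using total[OF that] R_right by (metis theI)
  have UI: "U x = y" if "R x y" for x y
    using R_right[OF RU that] that by (simp add: R_def)
  have UK: "U x \<in> hcarrier K" if "x \<in> hcarrier H" for x
    using RU[OF that] by (simp add: R_def)
  have Uin: "hinner K (U x) (v i) = hinner H x (u i)" if "x \<in> hcarrier H" for x i
    using RU[OF that] by (simp add: R_def)
  have "is_unitary H K U"
    unfolding is_unitary_def
  proof (intro conjI ballI allI)
    show "bij_betw U (hcarrier H) (hcarrier K)"
    proof (rule bij_betw_imageI)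
      show "inj_on U (hcarrier H)" using R_left RU by (metis inj_onI)
      show "U ` hcarrier H = hcarrier K"
        using surj UI UK by (auto simp: R_def image_iff) metis
    qed
  next
    fix x y assume x: "x \<in> hcarrier H" and y: "y \<in> hcarrier H"
    show "U (hadd H x y) = hadd K (U x) (U y)"
      using x y UK by (intro UI) (simp add: R_def uH vK H.inner_expand K.inner_expand Uin)
    \<comment> \<open>R controls inner products with members of the families only. One index
      sequence that approximates y and its image at once turns this into <U x, U y> = <x,
      y>.\<close>
    obtain y' i where y': "R y y'" "(\<lambda>n. hdist H (u (i n)) y) \<longlonglongrightarrow> 0" "(\<lambda>n. hdist K (v (i n)) y') \<longlonglongrightarrow> 0"
      using total[OF y] by blast
    have "y' = U y" using UI y' by simp
    then have "(\<lambda>n. hinner K (U x) (v (i n))) \<longlonglongrightarrow> hinner K (U x) (U y)"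
      using K.tendsto_inner_right[of "\<lambda>n. v (i n)" y' "U x"] y'(3) UK x y vK by simp
    moreover have "(\<lambda>n. hinner K (U x) (v (i n))) \<longlonglongrightarrow> hinner H x y"
      using H.tendsto_inner_right[of "\<lambda>n. u (i n)" y x] y'(2) x y uH by (simp add: Uin)
    ultimately show "hinner K (U x) (U y) = hinner H x y" by (rule LIMSEQ_unique)
  next
    fix c x assume x: "x \<in> hcarrier H"
    show "U (hscale H c x) = hscale K c (U x)"
      using x UK by (intro UI) (simp add: R_def uH vK H.inner_expand K.inner_expand Uin)
  qed
  moreover have "U (u i) = v i" for i
    by (rule UI) (simp add: R_def uH vK gram)
  ultimately show thesis by (rule that)
qed

section \<open>The Hardy space of the bidisc\<close>

definition ell2 :: "('k \<Rightarrow> complex) \<Rightarrow> bool" where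
  "ell2 a \<longleftrightarrow> (\<lambda>k. (cmod (a k))\<^sup>2) summable_on UNIV"

lemma ell2_mult_summable:
  assumes "ell2 a" "ell2 b"
  shows "(\<lambda>k. a k * b k) summable_on UNIV"
  by (rule Infinite_Sum.abs_summable_summable[OF Infinite_Sum.abs_summable_product])
    (use assms in \<open>simp_all add: ell2_def norm_mult power2_eq_square\<close>)

lemma ell2_cnj: "ell2 (\<lambda>k. cnj (b k)) \<longleftrightarrow> ell2 b"
  by (simp add: ell2_def)

lemma ell2_inner_summable: "ell2 a \<Longrightarrow> ell2 b \<Longrightarrow> (\<lambda>k. a k * cnj (b k)) summable_on UNIV"
  by (rule ell2_mult_summable) (simp_all add: ell2_cnj)

lemma ell2_scale: "ell2 a \<Longrightarrow> ell2 (\<lambda>k. c * a k)"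
  by (simp add: ell2_def norm_mult power_mult_distrib summable_on_cmult_right)

lemma cmod_add_sq_le: "(cmod (x + y))\<^sup>2 \<le> 2 * (cmod x)\<^sup>2 + 2 * (cmod y)\<^sup>2"
proof -
  have "(cmod (x + y))\<^sup>2 \<le> (cmod x + cmod y)\<^sup>2"
    by (simp add: norm_triangle_ineq power_mono)
  moreover have "0 \<le> (cmod x - cmod y)\<^sup>2" by simp
  ultimately show ?thesis by (simp add: power2_sum power2_diff)
qed

lemma ell2_add:
  assumes "ell2 a" "ell2 b"
  shows "ell2 (\<lambda>k. a k + b k)"
proof -
  have "(\<lambda>k. 2 * (cmod (a k))\<^sup>2 + 2 * (cmod (b k))\<^sup>2) summable_on UNIV"
    using assms by (intro summable_on_add summable_on_cmult_right) (simp_all add: ell2_def)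
  then have "(\<lambda>k. norm ((cmod (a k + b k))\<^sup>2)) summable_on UNIV"
    by (rule Infinite_Sum.abs_summable_on_comparison_test') (simp add: cmod_add_sq_le)
  then show ?thesis by (simp add: ell2_def)
qed

lemma ell2_diff: "ell2 a \<Longrightarrow> ell2 b \<Longrightarrow> ell2 (\<lambda>k. a k - b k)"
  using ell2_add[of a "\<lambda>k. (- 1) * b k"] ell2_scale[of b "-1"] by simp

lemma ell2_if_finite_support: "finite {k. a k \<noteq> 0} \<Longrightarrow> ell2 a"
  unfolding ell2_def by (rule summable_on_cong_neutral[THEN iffD1, of _ "{k. a k \<noteq> 0}"]) auto

text \<open>The coordinates converge separately. Over a finite set of coordinates the Cauchy bound
  survives the limit in m, and a bound uniform over finite sets bounds the infinite sum.\<close>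

lemma ell2_complete:
  fixes s :: "nat \<Rightarrow> 'k \<Rightarrow> complex"
  assumes s: "\<And>n. ell2 (s n)"
    and cauchy: "\<And>e. 0 < e \<Longrightarrow> \<exists>N. \<forall>m\<ge>N. \<forall>n\<ge>N. (\<Sum>\<^sub>\<infinity>k. (cmod (s m k - s n k))\<^sup>2) < e"
  obtains a where "ell2 a" "(\<lambda>n. \<Sum>\<^sub>\<infinity>k. (cmod (s n k - a k))\<^sup>2) \<longlonglongrightarrow> 0"
proof -
  have finite_le: "(\<Sum>k\<in>F. (cmod (s m k - s n k))\<^sup>2) \<le> (\<Sum>\<^sub>\<infinity>k. (cmod (s m k - s n k))\<^sup>2)"
    if "finite F" for F m n
    using ell2_diff[OF s[of m] s[of n]] that by (intro finite_sum_le_infsum) (auto simp: ell2_def)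
  have "Cauchy (\<lambda>n. s n k)" for k
  proof (rule metric_CauchyI)
    fix e :: real assume "0 < e"
    then obtain N where N: "\<forall>m\<ge>N. \<forall>n\<ge>N. (\<Sum>\<^sub>\<infinity>k. (cmod (s m k - s n k))\<^sup>2) < e\<^sup>2"
      using cauchy[of "e\<^sup>2"] by auto
    have "dist (s m k) (s n k) < e" if "m \<ge> N" "n \<ge> N" for m n
    proof (rule power2_less_imp_less)
      show "(dist (s m k) (s n k))\<^sup>2 < e\<^sup>2"
        using finite_le[of "{k}" m n] N that by (force simp: dist_norm)
    qed (use \<open>0 < e\<close> in simp)
    then show "\<exists>N. \<forall>m\<ge>N. \<forall>n\<ge>N. dist (s m k) (s n k) < e" by blast
  qed
  then have "\<exists>l. (\<lambda>n. s n k) \<longlonglongrightarrow> l" for k by (simp add: Cauchy_convergent_iff convergent_def)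
  then obtain a where a: "\<And>k. (\<lambda>n. s n k) \<longlonglongrightarrow> a k" by metis
  have limit: "\<exists>N. \<forall>n\<ge>N. ell2 (\<lambda>k. s n k - a k) \<and> (\<Sum>\<^sub>\<infinity>k. (cmod (s n k - a k))\<^sup>2) \<le> e" if e: "0 < e" for e
  proof -
    obtain N where N: "\<forall>m\<ge>N. \<forall>n\<ge>N. (\<Sum>\<^sub>\<infinity>k. (cmod (s m k - s n k))\<^sup>2) < e"
      using cauchy[OF e] by blast
    have fin: "(\<Sum>k\<in>F. (cmod (s n k - a k))\<^sup>2) \<le> e" if "n \<ge> N" "finite F" for n F
    proof (rule LIMSEQ_le_const2)
      show "(\<lambda>m. \<Sum>k\<in>F. (cmod (s n k - s m k))\<^sup>2) \<longlonglongrightarrow> (\<Sum>k\<in>F. (cmod (s n k - a k))\<^sup>2)"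
        by (intro tendsto_intros a)
      show "\<exists>M. \<forall>m\<ge>M. (\<Sum>k\<in>F. (cmod (s n k - s m k))\<^sup>2) \<le> e"
        using finite_le[OF that(2)] N that(1) by (meson less_imp_le order_trans)
    qed
    have "ell2 (\<lambda>k. s n k - a k)" if "n \<ge> N" for n
      unfolding ell2_def
      by (rule nonneg_bdd_above_summable_on) (use fin[OF that] in \<open>auto intro!: bdd_aboveI[of _ e]\<close>)
    moreover have "(\<Sum>\<^sub>\<infinity>k. (cmod (s n k - a k))\<^sup>2) \<le> e" if "n \<ge> N" for n
      by (rule infsum_le_finite_sums)
        (use fin[OF that] calculation[OF that] in \<open>auto simp: ell2_def\<close>)
    ultimately show ?thesis by blast
  qed
  obtain n where "ell2 (\<lambda>k. s n k - a k)" using limit[of 1] by auto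
  then have "ell2 (\<lambda>k. s n k - (s n k - a k))" by (rule ell2_diff[OF s])
  then have "ell2 a" by simp
  moreover have "(\<lambda>n. \<Sum>\<^sub>\<infinity>k. (cmod (s n k - a k))\<^sup>2) \<longlonglongrightarrow> 0"
  proof (rule LIMSEQ_I)
    fix r :: real assume "0 < r"
    then obtain N where "\<forall>n\<ge>N. (\<Sum>\<^sub>\<infinity>k. (cmod (s n k - a k))\<^sup>2) \<le> r / 2"
      using limit[of "r / 2"] by auto
    moreover have "0 \<le> (\<Sum>\<^sub>\<infinity>k. (cmod (s n k - a k))\<^sup>2)" for n by (rule infsum_nonneg) simp
    ultimately show "\<exists>N. \<forall>n\<ge>N. norm ((\<Sum>\<^sub>\<infinity>k. (cmod (s n k - a k))\<^sup>2) - 0) < r"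
      using \<open>0 < r\<close> by (intro exI[of _ N]) force
  qed
  ultimately show thesis by (rule that)
qed

section \<open>Uniqueness of Taylor coefficients\<close>

definition mon :: "nat \<times> nat \<Rightarrow> complex \<times> complex \<Rightarrow> complex" where
  "mon k x = fst x ^ fst k * snd x ^ snd k"

lemma has_taylor_iff:
  "has_taylor f a \<longleftrightarrow> (\<forall>x\<in>bidisc. ((\<lambda>k. a k * mon k x) has_sum f x) UNIV)"
  by (simp add: has_taylor_def mon_def case_prod_unfold mult.assoc)

text \<open>Convergence in the unit disc makes the radius of convergence at least 1, so the formal
  power series represents 0 near the origin and the identity theorem for \<open>eval_fps\<close>
  applies.\<close>

lemma powser_zero_imp_coeff_zero:
  fixes a :: "nat \<Rightarrow> complex"
  assumes "\<And>z. cmod z < 1 \<Longrightarrow> (\<lambda>n. a n * z ^ n) sums 0"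
  shows "a n = 0"
proof -
  have "1 \<le> conv_radius a"
    using assms by (subst le_conv_radius_iff[of _ _ 0, where r = 1, unfolded one_ereal_def, folded one_ereal_def])
      (auto simp: sums_iff)
  then have "0 < fps_conv_radius (Abs_fps a)"
    by (simp add: fps_conv_radius_def less_le_trans[of 0 1])
  moreover have "\<forall>\<^sub>F z in nhds 0. eval_fps (Abs_fps a) z = eval_fps 0 z"
  proof (rule eventually_nhds_in_open[of "ball 0 1", THEN eventually_mono])
    fix z :: complex assume "z \<in> ball 0 1"
    then have "(\<lambda>n. a n * z ^ n) sums 0" by (intro assms) simp
    then show "eval_fps (Abs_fps a) z = eval_fps 0 z" by (simp add: eval_fps_def sums_iff)
  qed auto
  ultimately have "Abs_fps a = 0" by (intro eval_fps_eqD) auto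
  then show ?thesis by (metis fps_nth_Abs_fps fps_zero_nth)
qed

text \<open>The one-variable statement is used twice. For fixed w the double sum is regrouped into a
  power series in z whose coefficients \<open>c j\<close> are the sums over k of
  \<open>a (j, k) * w ^ k\<close>; these vanish, and each is in turn a power series in w.\<close>

lemma has_taylor_zero:
  assumes "has_taylor (\<lambda>_. 0) a"
  shows "a k = 0"
proof -
  have inner: "(\<lambda>k. a (j, k) * w ^ k) sums 0" if w: "cmod w < 1" for w j
  proof -
    define r where "r z j = (\<Sum>\<^sub>\<infinity>k. a (j, k) * mon (j, k) (z, w))" for z j
    have rows: "(r z has_sum 0) UNIV \<and> (\<forall>j. ((\<lambda>k. a (j, k) * mon (j, k) (z, w)) has_sum r z j) UNIV)"
      if z: "cmod z < 1" for z
    proof -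
      have zw: "((\<lambda>k. a k * mon k (z, w)) has_sum 0) (UNIV \<times> UNIV)"
        using assms z w by (auto simp: has_taylor_iff bidisc_def)
      have row: "((\<lambda>k. a (j, k) * mon (j, k) (z, w)) has_sum r z j) UNIV" for j
      proof -
        have "(\<lambda>(j, k). a (j, k) * mon (j, k) (z, w)) summable_on (UNIV \<times> UNIV)"
          using zw by (auto simp: summable_on_def case_prod_unfold)
        then have "(\<lambda>k. a (j, k) * mon (j, k) (z, w)) summable_on UNIV"
          by (rule summable_on_SigmaD1) simp
        then show ?thesis by (simp add: r_def)
      qed
      then show ?thesis using has_sum_SigmaD[OF zw, of "r z"] by simp
    qed
    define c where "c j = (\<Sum>\<^sub>\<infinity>k. a (j, k) * w ^ k)" for j
    have r: "r z j = c j * z ^ j" for z j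
    proof -
      have "r z j = (\<Sum>\<^sub>\<infinity>k. a (j, k) * w ^ k * z ^ j)"
        by (simp add: r_def mon_def mult_ac)
      then show ?thesis by (simp only: c_def infsum_cmult_left')
    qed
    have "(\<lambda>j. c j * z ^ j) sums 0" if "cmod z < 1" for z
    proof -
      have "(\<lambda>j. c j * z ^ j) = r z" by (simp add: r fun_eq_iff)
      then show ?thesis using rows[OF that] has_sum_imp_sums by metis
    qed
    then have c: "c j = 0" by (rule powser_zero_imp_coeff_zero)
    \<comment> \<open>Any z with 0 < |z| < 1 would serve: row j sums to
      \<open>c j * z ^ j = 0\<close>, and the factor 2^j cancels z^j.\<close>
    have "((\<lambda>k. a (j, k) * mon (j, k) (1 / 2, w)) has_sum r (1 / 2) j) UNIV"
      using rows[of "1 / 2"] by (simp add: norm_divide)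
    then have "((\<lambda>k. 2 ^ j * (a (j, k) * mon (j, k) (1 / 2, w))) has_sum 2 ^ j * 0) UNIV"
      using r c by (intro has_sum_cmult_right) simp
    then have "((\<lambda>k. a (j, k) * w ^ k) has_sum 0) UNIV"
      by (simp add: mon_def power_divide)
    then show ?thesis by (rule has_sum_imp_sums)
  qed
  obtain j l where k: "k = (j, l)" by fastforce
  show ?thesis unfolding k by (rule powser_zero_imp_coeff_zero[of "\<lambda>l. a (j, l)"]) (rule inner)
qed

lemma has_taylor_unique:
  assumes "has_taylor f a" "has_taylor f b"
  shows "a = b"
proof
  fix k
  have "has_taylor (\<lambda>_. 0) (\<lambda>k. a k - b k)"
    unfolding has_taylor_iff
  proof
    fix x assume "x \<in> bidisc"
    then have "((\<lambda>k. a k * mon k x + - (b k * mon k x)) has_sum f x + - f x) UNIV"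
      using assms by (intro has_sum_add) (auto simp: has_taylor_iff has_sum_uminus)
    then show "((\<lambda>k. (a k - b k) * mon k x) has_sum 0) UNIV"
      by (simp add: algebra_simps)
  qed
  from has_taylor_zero[OF this, of k] show "a k = b k" by simp
qed

lemma taylor_eqI: "has_taylor f a \<Longrightarrow> taylor f = a"
  unfolding taylor_def using has_taylor_unique by blast

section \<open>The Hardy space as a Hilbert space\<close>

lemma summable_on_geometric: "0 \<le> r \<Longrightarrow> r < 1 \<Longrightarrow> (\<lambda>n. (r :: real) ^ n) summable_on UNIV"
  by (subst summable_on_UNIV_nonneg_real_iff) (auto intro: summable_geometric)

text \<open>The squares form a product of two geometric series; their sum is the Szego kernel on the
  diagonal. Together with \<open>ell2_mult_summable\<close> this makes the power series of every
  square summable family converge at x.\<close>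

lemma ell2_mon:
  assumes "x \<in> bidisc"
  shows "ell2 (\<lambda>k. mon k x)"
proof -
  obtain z w where x: "x = (z, w)" by fastforce
  define r s where "r = (cmod z)\<^sup>2" and "s = (cmod w)\<^sup>2"
  have r: "0 \<le> r" "r < 1" and s: "0 \<le> s" "s < 1"
    using assms by (auto simp: x r_def s_def bidisc_def abs_square_less_1)
  have "(\<lambda>(j, k). r ^ j * s ^ k) summable_on (UNIV \<times> UNIV)"
  proof (rule summable_on_SigmaI)
    show "((\<lambda>k. case (j, k) of (j, k) \<Rightarrow> r ^ j * s ^ k) has_sum r ^ j * (\<Sum>\<^sub>\<infinity>k. s ^ k)) UNIV" for j
      using s by (simp add: has_sum_cmult_right summable_on_geometric)
    show "(\<lambda>j. r ^ j * (\<Sum>\<^sub>\<infinity>k. s ^ k)) summable_on UNIV"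
      by (rule summable_on_cmult_left) (simp add: summable_on_geometric r)
  qed (use r s in auto)
  moreover have "(cmod (mon k x))\<^sup>2 = (\<lambda>(j, k). r ^ j * s ^ k) k" for k
    by (simp add: mon_def x r_def s_def norm_mult norm_power case_prod_unfold power_mult_distrib
        power2_eq_square)
  ultimately show ?thesis by (simp add: ell2_def)
qed

definition power_series :: "(nat \<times> nat \<Rightarrow> complex) \<Rightarrow> complex \<times> complex \<Rightarrow> complex" where
  "power_series a = (\<lambda>x\<in>bidisc. \<Sum>\<^sub>\<infinity>k. a k * mon k x)"

lemma has_taylor_power_series: "ell2 a \<Longrightarrow> has_taylor (power_series a) a"
  by (auto simp: has_taylor_iff power_series_def intro!: has_sum_infsum ell2_mult_summable ell2_mon)

lemma mem_hardy2: "f \<in> hcarrier hardy2 \<longleftrightarrow> f \<in> extensional bidisc \<and> (\<exists>a. has_taylor f a \<and> ell2 a)"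
  by (simp add: hardy2_def ell2_def)

lemma mem_hardy2I: "f \<in> extensional bidisc \<Longrightarrow> has_taylor f a \<Longrightarrow> ell2 a \<Longrightarrow> f \<in> hcarrier hardy2"
  by (auto simp: mem_hardy2)

lemma has_taylor_taylor: "f \<in> hcarrier hardy2 \<Longrightarrow> has_taylor f (taylor f)"
  by (auto simp: mem_hardy2 taylor_eqI)

lemma ell2_taylor: "f \<in> hcarrier hardy2 \<Longrightarrow> ell2 (taylor f)"
  by (auto simp: mem_hardy2 taylor_eqI)

text \<open>Inside the bidisc both functions are sums of the same series; outside it
  \<open>extensional\<close> fixes their value.\<close>

lemma hardy2_eqI:
  assumes f: "f \<in> hcarrier hardy2" and g: "g \<in> hcarrier hardy2" and eq: "taylor f = taylor g"
  shows "f = g"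
proof (rule extensionalityI[of _ bidisc])
  fix x assume "x \<in> bidisc"
  then show "f x = g x"
    using has_taylor_taylor[OF f] has_taylor_taylor[OF g]
    by (auto simp: has_taylor_iff eq intro: has_sum_unique)
qed (use f g in \<open>auto simp: mem_hardy2\<close>)

lemma hinner_hardy2: "hinner hardy2 f g = (\<Sum>\<^sub>\<infinity>k. taylor f k * cnj (taylor g k))"
  by (simp add: hardy2_def)

lemma has_taylor_hadd:
  "has_taylor f a \<Longrightarrow> has_taylor g b \<Longrightarrow> has_taylor (hadd hardy2 f g) (\<lambda>k. a k + b k)"
  by (simp add: has_taylor_iff hardy2_def distrib_right has_sum_add)

lemma has_taylor_hscale:
  "has_taylor f a \<Longrightarrow> has_taylor (hscale hardy2 c f) (\<lambda>k. c * a k)"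
  by (simp add: has_taylor_iff hardy2_def mult.assoc has_sum_cmult_right)

lemma hadd_hardy2:
  assumes "f \<in> hcarrier hardy2" "g \<in> hcarrier hardy2"
  shows "hadd hardy2 f g \<in> hcarrier hardy2"
    and "taylor (hadd hardy2 f g) = (\<lambda>k. taylor f k + taylor g k)"
proof -
  note h = has_taylor_hadd[OF assms[THEN has_taylor_taylor]]
  show "hadd hardy2 f g \<in> hcarrier hardy2"
    by (rule mem_hardy2I[OF _ h ell2_add[OF assms[THEN ell2_taylor]]]) (simp add: hardy2_def)
  show "taylor (hadd hardy2 f g) = (\<lambda>k. taylor f k + taylor g k)" by (rule taylor_eqI[OF h])
qed

lemma hscale_hardy2:
  assumes "f \<in> hcarrier hardy2"
  shows "hscale hardy2 c f \<in> hcarrier hardy2"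
    and "taylor (hscale hardy2 c f) = (\<lambda>k. c * taylor f k)"
proof -
  note h = has_taylor_hscale[OF has_taylor_taylor[OF assms]]
  show "hscale hardy2 c f \<in> hcarrier hardy2"
    by (rule mem_hardy2I[OF _ h ell2_scale[OF ell2_taylor[OF assms]]]) (simp add: hardy2_def)
  show "taylor (hscale hardy2 c f) = (\<lambda>k. c * taylor f k)" by (rule taylor_eqI[OF h])
qed

lemma hdiff_hardy2:
  assumes "f \<in> hcarrier hardy2" "g \<in> hcarrier hardy2"
  shows "hdiff hardy2 f g \<in> hcarrier hardy2"
    and "taylor (hdiff hardy2 f g) = (\<lambda>k. taylor f k - taylor g k)"
  using assms by (simp_all add: hdiff_def hadd_hardy2 hscale_hardy2)

lemma hinner_hardy2_self:
  assumes "f \<in> hcarrier hardy2"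
  shows "hinner hardy2 f f = complex_of_real (\<Sum>\<^sub>\<infinity>k. (cmod (taylor f k))\<^sup>2)"
proof -
  have "((\<lambda>k. complex_of_real ((cmod (taylor f k))\<^sup>2)) has_sum
      complex_of_real (\<Sum>\<^sub>\<infinity>k. (cmod (taylor f k))\<^sup>2)) UNIV"
    using ell2_taylor[OF assms] by (intro has_sum_of_real has_sum_infsum) (simp add: ell2_def)
  then show ?thesis
    unfolding hinner_hardy2 complex_norm_square by (rule infsumI)
qed

lemma hdist_hardy2:
  assumes "f \<in> hcarrier hardy2" "g \<in> hcarrier hardy2"
  shows "hdist hardy2 f g = sqrt (\<Sum>\<^sub>\<infinity>k. (cmod (taylor f k - taylor g k))\<^sup>2)"
  using assms by (simp add: hnorm_def hinner_hardy2_self hdiff_hardy2)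

text \<open>Through \<open>taylor\<close> each law becomes one about square summable families. The
  limit of a Cauchy sequence is the power series of the \<open>ell2\<close> limit of its
  coefficients.\<close>

interpretation hardy2: hilbert hardy2
proof unfold_locales
  have "has_taylor (\<lambda>x\<in>bidisc. 0) (\<lambda>_. 0)" by (simp add: has_taylor_iff)
  then show "hcarrier hardy2 \<noteq> {}"
    using mem_hardy2I[of "\<lambda>x\<in>bidisc. 0" "\<lambda>_. 0"] by (auto simp: ell2_def)
  fix f g h :: "complex \<times> complex \<Rightarrow> complex" and c :: complex
  assume f: "f \<in> hcarrier hardy2"
  show "hscale hardy2 c f \<in> hcarrier hardy2" by (rule hscale_hardy2[OF f])
  show "0 \<le> Re (hinner hardy2 f f)"
    by (simp add: hinner_hardy2_self f infsum_nonneg)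
  assume g: "g \<in> hcarrier hardy2"
  show "hadd hardy2 f g \<in> hcarrier hardy2" by (rule hadd_hardy2[OF f g])
  show "hinner hardy2 (hscale hardy2 c f) g = c * hinner hardy2 f g"
    by (simp add: hinner_hardy2 hscale_hardy2 f mult.assoc infsum_cmult_right')
  show "hinner hardy2 g f = cnj (hinner hardy2 f g)"
    by (simp add: hinner_hardy2 mult.commute flip: infsum_cnj)
  show "f = g" if "hinner hardy2 (hdiff hardy2 f g) (hdiff hardy2 f g) = 0"
  proof (rule hardy2_eqI[OF f g])
    define d where "d = hdiff hardy2 f g"
    have d: "d \<in> hcarrier hardy2" unfolding d_def by (rule hdiff_hardy2[OF f g])
    then have "(\<Sum>\<^sub>\<infinity>k. (cmod (taylor d k))\<^sup>2) \<le> 0"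
      using that hinner_hardy2_self[OF d] by (simp add: d_def)
    then have "(cmod (taylor d k))\<^sup>2 = 0" for k
      using ell2_taylor[OF d] by (intro nonneg_infsum_le_0D[of "\<lambda>k. (cmod (taylor d k))\<^sup>2" UNIV])
        (auto simp: ell2_def)
    then show "taylor f = taylor g" by (simp add: d_def hdiff_hardy2 f g fun_eq_iff)
  qed
  assume h: "h \<in> hcarrier hardy2"
  show "hinner hardy2 (hadd hardy2 f g) h = hinner hardy2 f h + hinner hardy2 g h"
    by (simp add: hinner_hardy2 hadd_hardy2 f g distrib_right infsum_add ell2_inner_summable ell2_taylor h)
next
  show "hcomplete hardy2"
    unfolding hcomplete_def
  proof (intro allI impI)
    fix s :: "nat \<Rightarrow> complex \<times> complex \<Rightarrow> complex"
    assume s: "\<forall>n. s n \<in> hcarrier hardy2"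
      and cauchy: "\<forall>e>0. \<exists>N. \<forall>m\<ge>N. \<forall>n\<ge>N. hdist hardy2 (s m) (s n) < e"
    obtain a where a: "ell2 a" "(\<lambda>n. \<Sum>\<^sub>\<infinity>k. (cmod (taylor (s n) k - a k))\<^sup>2) \<longlonglongrightarrow> 0"
    proof (rule ell2_complete[of "\<lambda>n. taylor (s n)"])
      fix e :: real assume "0 < e"
      then obtain N where N: "\<forall>m\<ge>N. \<forall>n\<ge>N. hdist hardy2 (s m) (s n) < sqrt e"
        using cauchy by (meson real_sqrt_gt_zero)
      then show "\<exists>N. \<forall>m\<ge>N. \<forall>n\<ge>N. (\<Sum>\<^sub>\<infinity>k. (cmod (taylor (s m) k - taylor (s n) k))\<^sup>2) < e"
        using s by (intro exI[of _ N]) (simp add: hdist_hardy2)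
    qed (use s ell2_taylor in auto)
    have t: "has_taylor (power_series a) a" by (rule has_taylor_power_series[OF a(1)])
    then have mem: "power_series a \<in> hcarrier hardy2"
      by (rule mem_hardy2I[rotated]) (use a in \<open>simp_all add: power_series_def\<close>)
    have "(\<lambda>n. hdist hardy2 (s n) (power_series a)) \<longlonglongrightarrow> 0"
      using tendsto_real_sqrt[OF a(2)] s mem by (simp add: hdist_hardy2 taylor_eqI[OF t])
    with mem show "\<exists>x\<in>hcarrier hardy2. (\<lambda>n. hdist hardy2 (s n) x) \<longlonglongrightarrow> 0" by blast
  qed
qed

text \<open>Multiplication by a monomial moves the Taylor coefficients along the injection \<sigma>
  and puts 0 elsewhere, which changes no inner product. Both z and w are instances.\<close>

lemma isometry_monomial_mult:
  assumes \<sigma>: "inj \<sigma>" and m: "\<And>k x. mon (\<sigma> k) x = m x * mon k x"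
  shows "isometry_on hardy2 (\<lambda>f. \<lambda>x\<in>bidisc. m x * f x)"
proof -
  define A where "A f = (\<lambda>x\<in>bidisc. m x * f x)" for f :: "complex \<times> complex \<Rightarrow> complex"
  define sh where "sh a k = (if k \<in> range \<sigma> then a (inv \<sigma> k) else 0)"
    for a :: "nat \<times> nat \<Rightarrow> complex" and k
  \<comment> \<open>Kept general in the type of the terms: it is applied to complex sums and to real
    sums of squares.\<close>
  have reindex: "(b has_sum x) UNIV \<longleftrightarrow> ((\<lambda>k. b (\<sigma> k)) has_sum x) UNIV"
    if "\<And>k. k \<notin> range \<sigma> \<Longrightarrow> b k = 0" for b :: "nat \<times> nat \<Rightarrow> 'b::{comm_monoid_add, topological_space}" and x
  proof -
    have "(b has_sum x) UNIV \<longleftrightarrow> (b has_sum x) (range \<sigma>)"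
      by (rule has_sum_cong_neutral) (use that in auto)
    then show ?thesis using has_sum_reindex[OF \<sigma>, of b x] by (simp add: o_def)
  qed
  have sh: "sh a (\<sigma> k) = a k" "k \<notin> range \<sigma> \<Longrightarrow> sh a k = 0" for a k
    by (simp_all add: sh_def \<sigma>)
  have taylor_A: "has_taylor (A f) (sh a)" if "has_taylor f a" for f a
    unfolding has_taylor_iff
  proof
    fix x assume x: "x \<in> bidisc"
    then have "((\<lambda>k. m x * (a k * mon k x)) has_sum m x * f x) UNIV"
      using that by (intro has_sum_cmult_right) (simp add: has_taylor_iff)
    then show "((\<lambda>k. sh a k * mon k x) has_sum A f x) UNIV"
      using x by (subst reindex) (simp_all add: sh m A_def ac_simps)
  qed
  have ell2_sh: "ell2 (sh a)" if a: "ell2 a" for a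
  proof -
    obtain l where "((\<lambda>k. (cmod (a k))\<^sup>2) has_sum l) UNIV"
      using a unfolding ell2_def summable_on_def by blast
    then have "((\<lambda>k. (cmod (sh a k))\<^sup>2) has_sum l) UNIV"
      by (subst reindex) (simp_all add: sh)
    then show ?thesis by (auto simp: ell2_def summable_on_def)
  qed
  have A: "A f \<in> hcarrier hardy2" "taylor (A f) = sh (taylor f)" if f: "f \<in> hcarrier hardy2" for f
  proof -
    note t = taylor_A[OF has_taylor_taylor[OF f]]
    show "taylor (A f) = sh (taylor f)" by (rule taylor_eqI[OF t])
    show "A f \<in> hcarrier hardy2"
      by (rule mem_hardy2I[OF _ t ell2_sh[OF ell2_taylor[OF f]]]) (simp add: A_def)
  qed
  have "isometry_on hardy2 A"
    unfolding isometry_on_def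
  proof (intro conjI ballI allI)
    fix f g assume f: "f \<in> hcarrier hardy2" and g: "g \<in> hcarrier hardy2"
    have "((\<lambda>k. taylor f k * cnj (taylor g k)) has_sum hinner hardy2 f g) UNIV"
      unfolding hinner_hardy2 using f g by (intro has_sum_infsum ell2_inner_summable ell2_taylor)
    then have "((\<lambda>k. sh (taylor f) k * cnj (sh (taylor g) k)) has_sum hinner hardy2 f g) UNIV"
      by (subst reindex) (simp_all add: sh)
    then show "hinner hardy2 (A f) (A g) = hinner hardy2 f g"
      by (simp add: hinner_hardy2 A f g infsumI)
  qed (auto simp: A, auto simp: A_def hardy2_def fun_eq_iff restrict_def algebra_simps)
  then show ?thesis by (simp add: A_def[abs_def])
qed

lemma isometry_R_z: "isometry_on hardy2 R_z"
proof -
  have "R_z = (\<lambda>f. \<lambda>x\<in>bidisc. fst x * f x)" by (simp add: R_z_def fun_eq_iff)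
  then show ?thesis
    using isometry_monomial_mult[of "\<lambda>(j, k). (Suc j, k)" fst]
    by (simp add: mon_def inj_def case_prod_unfold prod_eq_iff)
qed

lemma isometry_R_w: "isometry_on hardy2 R_w"
proof -
  have "R_w = (\<lambda>f. \<lambda>x\<in>bidisc. snd x * f x)" by (simp add: R_w_def fun_eq_iff)
  then show ?thesis
    using isometry_monomial_mult[of "\<lambda>(j, k). (j, Suc k)" snd]
    by (simp add: mon_def inj_def case_prod_unfold prod_eq_iff)
qed

text \<open>The coefficient of \<open>z\<^sup>j w\<^sup>k\<close>, indexed by \<open>(j, k)\<close> as the Taylor coefficients are.\<close>

definition cf :: "complex poly poly \<Rightarrow> nat \<times> nat \<Rightarrow> complex" where
  "cf p = (\<lambda>(j, k). coeff (coeff p k) j)"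

section \<open>Polynomials through their coefficients\<close>

lemma cf_eq_iff: "p = q \<longleftrightarrow> cf p = cf q"
  by (auto simp: cf_def poly_eq_iff fun_eq_iff)

lemma cf_0 [simp]: "cf 0 k = 0"
  by (simp add: cf_def split: prod.splits)

lemma cf_add: "cf (p + q) k = cf p k + cf q k"
  by (simp add: cf_def split: prod.splits)

lemma cf_sum: "cf (sum f A) k = (\<Sum>i\<in>A. cf (f i) k)"
  by (induction A rule: infinite_finite_induct) (simp_all add: cf_add)

lemma cf_mult: "cf (p * q) (j, k) = (\<Sum>i\<le>j. \<Sum>l\<le>k. cf p (i, l) * cf q (j - i, k - l))"
  by (simp add: cf_def coeff_mult coeff_sum) (subst sum.swap, simp)

lemma finite_cf_support: "finite {k. cf p k \<noteq> 0}"
proof (rule finite_subset)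
  define N where "N = Max ((\<lambda>k. degree (coeff p k)) ` {..degree p})"
  show "{k. cf p k \<noteq> 0} \<subseteq> {..N} \<times> {..degree p}"
  proof clarsimp
    fix j k assume nz: "cf p (j, k) \<noteq> 0"
    then have k: "k \<le> degree p" and "j \<le> degree (coeff p k)"
      by (auto simp: cf_def intro!: le_degree)
    then show "j \<le> N \<and> k \<le> degree p"
      unfolding N_def by (meson Max_ge atMost_iff finite_atMost finite_imageI image_eqI order_trans)
  qed
qed simp

text \<open>F is any finite set containing the support, so that two polynomials can later be
  expanded over the same index set.\<close>

lemma bieval_eq_sum:
  assumes "finite F" "{k. cf p k \<noteq> 0} \<subseteq> F"
  shows "bieval p x = (\<Sum>k\<in>F. cf p k * mon k x)"
proof -
  obtain z w where x: "x = (z, w)" by fastforce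
  define G where "G = Sigma {..degree p} (\<lambda>k. {..degree (coeff p k)})"
  have "bieval p x = (\<Sum>k\<le>degree p. \<Sum>j\<le>degree (coeff p k). cf p (j, k) * mon (j, k) x)"
    by (simp add: x bieval_def poly_altdef[of p] poly_sum poly_power poly_mult)
      (simp add: poly_altdef[of "coeff p _"] sum_distrib_right cf_def mon_def mult.assoc)
  also have "\<dots> = (\<Sum>(k, j)\<in>G. cf p (j, k) * mon (j, k) x)"
    unfolding G_def by (rule sum.Sigma) simp_all
  \<comment> \<open>Nested coefficients come with the exponent of w first, \<open>cf\<close> is
    indexed with the exponent of z first; hence the swap.\<close>
  also have "\<dots> = (\<Sum>k\<in>prod.swap ` G. cf p k * mon k x)"
    by (subst sum.reindex) (auto simp: case_prod_unfold prod.swap_def)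
  also have "\<dots> = (\<Sum>k\<in>{k. cf p k \<noteq> 0}. cf p k * mon k x)"
  proof (rule sum.mono_neutral_right)
    show "{k. cf p k \<noteq> 0} \<subseteq> prod.swap ` G"
    proof clarify
      fix j k assume nz: "cf p (j, k) \<noteq> 0"
      then have "(k, j) \<in> G" by (auto simp: G_def cf_def intro!: le_degree)
      then show "(j, k) \<in> prod.swap ` G" by force
    qed
  qed (auto simp: G_def)
  also have "\<dots> = (\<Sum>k\<in>F. cf p k * mon k x)"
    by (rule sum.mono_neutral_left) (use assms in auto)
  finally show ?thesis .
qed

lemma has_taylor_hardy_poly: "has_taylor (hardy_poly p) (cf p)"
  unfolding has_taylor_iff
proof
  fix x assume "x \<in> bidisc"
  have "((\<lambda>k. cf p k * mon k x) has_sum bieval p x) {k. cf p k \<noteq> 0}"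
    using finite_cf_support by (simp add: bieval_eq_sum[of "{k. cf p k \<noteq> 0}"])
  then show "((\<lambda>k. cf p k * mon k x) has_sum hardy_poly p x) UNIV"
    using \<open>x \<in> bidisc\<close>
    by (subst has_sum_cong_neutral[of "{k. cf p k \<noteq> 0}" _ _ "\<lambda>k. cf p k * mon k x"])
      (auto simp: hardy_poly_def)
qed

lemma taylor_hardy_poly: "taylor (hardy_poly p) = cf p"
  by (rule taylor_eqI[OF has_taylor_hardy_poly])

lemma hardy_poly_mem [simp]: "hardy_poly p \<in> hcarrier hardy2"
  by (rule mem_hardy2I[OF _ has_taylor_hardy_poly])
    (simp_all add: hardy_poly_def ell2_if_finite_support finite_cf_support)

text \<open>The choice of F is left free: it is the union of the supports in \<open>Parseval\<close>
  and the empty set in \<open>homog_orthogonal\<close>.\<close>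

lemma hinner_hardy_poly:
  assumes "finite F" "{k. cf p k \<noteq> 0} \<inter> {k. cf q k \<noteq> 0} \<subseteq> F"
  shows "hinner hardy2 (hardy_poly p) (hardy_poly q) = (\<Sum>k\<in>F. cf p k * cnj (cf q k))"
proof -
  have "hinner hardy2 (hardy_poly p) (hardy_poly q) = (\<Sum>\<^sub>\<infinity>k\<in>F. cf p k * cnj (cf q k))"
    unfolding hinner_hardy2 taylor_hardy_poly by (rule infsum_cong_neutral) (use assms in auto)
  then show ?thesis using assms by simp
qed

text \<open>Homogeneity becomes a support condition, which the zero polynomial satisfies for every
  n. Products and orthogonality are then read off from coefficients.\<close>

lemma homog_iff: "h \<in> homog n \<longleftrightarrow> (\<forall>j k. j + k \<noteq> n \<longrightarrow> cf h (j, k) = 0)"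
proof
  assume "h \<in> homog n"
  then obtain c where "h = (\<Sum>j\<le>n. monom (monom (c j) j) (n - j))" by (auto simp: homog_def)
  then show "\<forall>j k. j + k \<noteq> n \<longrightarrow> cf h (j, k) = 0"
    by (auto simp: cf_def coeff_sum intro!: sum.neutral split: if_splits)
next
  assume zero: "\<forall>j k. j + k \<noteq> n \<longrightarrow> cf h (j, k) = 0"
  have "h = (\<Sum>j\<le>n. monom (monom (cf h (j, n - j)) j) (n - j))"
    unfolding cf_eq_iff
  proof
    fix x :: "nat \<times> nat"
    obtain j k where x: "x = (j, k)" by fastforce
    have "cf (\<Sum>i\<le>n. monom (monom (cf h (i, n - i)) i) (n - i)) x
        = (\<Sum>i\<le>n. if i = j then if n - j = k then cf h (j, n - j) else 0 else 0)"
      unfolding cf_sum by (rule sum.cong) (auto simp: cf_def x)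
    also have "\<dots> = cf h x" using zero by (auto simp: x)
    finally show "cf h x = cf (\<Sum>i\<le>n. monom (monom (cf h (i, n - i)) i) (n - i)) x" ..
  qed
  then show "h \<in> homog n" by (auto simp: homog_def)
qed

lemma homog_mult:
  assumes "p \<in> homog m" "q \<in> homog n"
  shows "p * q \<in> homog (m + n)"
  unfolding homog_iff
proof (intro allI impI)
  fix j k assume "j + k \<noteq> m + n"
  \<comment> \<open>A nonzero term of the convolution would need i + l = m and (j - i) + (k - l) =
    n, which add up to j + k = m + n.\<close>
  then have "i + l \<noteq> m \<or> (j - i) + (k - l) \<noteq> n" if "i \<le> j" "l \<le> k" for i l
    using that by arith
  then have "cf p (i, l) = 0 \<or> cf q (j - i, k - l) = 0" if "i \<le> j" "l \<le> k" for i l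
    using that assms unfolding homog_iff by blast
  then show "cf (p * q) (j, k) = 0" by (auto simp: cf_mult intro!: sum.neutral)
qed

lemma homog_orthogonal:
  assumes "p \<in> homog m" "q \<in> homog n" "m \<noteq> n"
  shows "hinner hardy2 (hardy_poly p) (hardy_poly q) = 0"
proof -
  have "{k. cf p k \<noteq> 0} \<inter> {k. cf q k \<noteq> 0} = {}"
    using assms unfolding homog_iff by (auto, metis)
  then show ?thesis by (subst hinner_hardy_poly[of "{}"]) auto
qed

section \<open>The space \<open>L\<^sup>2(M)\<close>\<close>

lemma borel_measurable_cnj [measurable]: "cnj \<in> borel_measurable borel"
  by (intro borel_measurable_continuous_onI continuous_intros)

lemma sq_integrable_iff: "f \<in> sq_integrable M \<longleftrightarrow>
    f \<in> borel_measurable M \<and> integrable M (\<lambda>x. (cmod (f x))\<^sup>2)"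
  by (simp add: sq_integrable_def)

lemma sq_integrable_add:
  assumes "f \<in> sq_integrable M" "g \<in> sq_integrable M"
  shows "(\<lambda>x. f x + g x) \<in> sq_integrable M"
proof -
  have [measurable]: "f \<in> borel_measurable M" "g \<in> borel_measurable M"
    using assms by (simp_all add: sq_integrable_iff)
  have "integrable M (\<lambda>x. 2 * (cmod (f x))\<^sup>2 + 2 * (cmod (g x))\<^sup>2)"
    using assms by (simp add: sq_integrable_iff)
  then have "integrable M (\<lambda>x. (cmod (f x + g x))\<^sup>2)"
    by (rule Bochner_Integration.integrable_bound) (auto intro!: cmod_add_sq_le)
  then show ?thesis by (simp add: sq_integrable_iff)
qed

lemma sq_integrable_scale: "f \<in> sq_integrable M \<Longrightarrow> (\<lambda>x. c * f x) \<in> sq_integrable M"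
  by (auto simp: sq_integrable_iff norm_mult power_mult_distrib)

lemma sq_integrable_diff:
  "f \<in> sq_integrable M \<Longrightarrow> g \<in> sq_integrable M \<Longrightarrow> (\<lambda>x. f x - g x) \<in> sq_integrable M"
  using sq_integrable_add[of f M "\<lambda>x. (- 1) * g x"] sq_integrable_scale[of g M "- 1"] by simp

lemma sq_integrable_inner:
  assumes "f \<in> sq_integrable M" "g \<in> sq_integrable M"
  shows "integrable M (\<lambda>x. f x * cnj (g x))"
proof -
  have [measurable]: "f \<in> borel_measurable M" "g \<in> borel_measurable M"
    using assms by (simp_all add: sq_integrable_iff)
  have "integrable M (\<lambda>x. (cmod (f x))\<^sup>2 + (cmod (g x))\<^sup>2)"
    using assms by (simp add: sq_integrable_iff)
  then show ?thesis
  proof (rule Bochner_Integration.integrable_bound)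
    have "cmod (f x) * cmod (g x) \<le> (cmod (f x))\<^sup>2 + (cmod (g x))\<^sup>2" for x
      using sum_squares_bound[of "cmod (f x)" "cmod (g x)"]
        mult_nonneg_nonneg[OF norm_ge_zero[of "f x"] norm_ge_zero[of "g x"]] by linarith
    then show "AE x in M. norm (f x * cnj (g x)) \<le> norm ((cmod (f x))\<^sup>2 + (cmod (g x))\<^sup>2)"
      by (simp add: norm_mult)
  qed (measurable)
qed

lemma sq_integrable_cong_AE:
  assumes "f \<in> sq_integrable M" "g \<in> borel_measurable M" "AE x in M. f x = g x"
  shows "g \<in> sq_integrable M"
proof -
  have [measurable]: "f \<in> borel_measurable M" "g \<in> borel_measurable M"
    using assms by (simp_all add: sq_integrable_iff)
  have "integrable M (\<lambda>x. (cmod (g x))\<^sup>2)"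
    using assms by (subst integrable_cong_AE[of _ _ "\<lambda>x. (cmod (f x))\<^sup>2"]) (auto simp: sq_integrable_iff)
  with assms show ?thesis by (simp add: sq_integrable_iff)
qed

lemma nn_integral_eq_sq:
  "f \<in> sq_integrable M \<Longrightarrow> (\<integral>\<^sup>+x. ennreal ((cmod (f x))\<^sup>2) \<partial>M) = ennreal (\<integral>x. (cmod (f x))\<^sup>2 \<partial>M)"
  by (rule nn_integral_eq_integral) (simp_all add: sq_integrable_iff)

text \<open>The increments \<open>d k\<close> have integrals at most C 2^(-k), so their sum is
  integrable, hence finite almost everywhere, and the telescoping series converges absolutely there.
  Finiteness of the measure turns the L^2 bounds into L^1 bounds.\<close>

lemma AE_convergent_if_fast_Cauchy:
  fixes g :: "nat \<Rightarrow> 'a \<Rightarrow> complex"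
  assumes "finite_measure M" and g: "\<And>k. g k \<in> sq_integrable M"
    and fast: "\<And>k. (\<integral>x. (cmod (g (Suc k) x - g k x))\<^sup>2 \<partial>M) \<le> (1 / 4) ^ k"
  shows "AE x in M. convergent (\<lambda>k. g k x)"
proof -
  interpret finite_measure M by fact
  have [measurable]: "g k \<in> borel_measurable M" for k using g by (simp add: sq_integrable_iff)
  define d where "d k x = cmod (g (Suc k) x - g k x)" for k x
  have [measurable]: "d k \<in> borel_measurable M" for k unfolding d_def by measurable
  have d0: "0 \<le> d k x" for k x by (simp add: d_def)
  have int: "integrable M (\<lambda>x. (d k x)\<^sup>2)" for k
    using sq_integrable_diff[OF g g] by (simp add: d_def sq_integrable_iff)
  \<comment> \<open>The 1 comes from 2^k 4^(-k) = 2^(-k), the total mass from integrating the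
    constant 2^(-k).\<close>
  define C where "C = 1 + measure M (space M)"
  have bound: "(\<integral>\<^sup>+x. ennreal (d k x) \<partial>M) \<le> ennreal (C * (1 / 2) ^ k)" for k
  proof -
    have "d k x \<le> 2 ^ k * (d k x)\<^sup>2 + (1 / 2) ^ k" for x
    proof -
      \<comment> \<open>The weight 2^k uses up only half of the decay 4^(-k). The result is 2 d <=
        2^k d^2 + 2^(-k), and d <= 2 d since d >= 0.\<close>
      have "0 \<le> 2 ^ k * (d k x - (1 / 2) ^ k)\<^sup>2" by simp
      also have "\<dots> = 2 ^ k * (d k x)\<^sup>2 - 2 * d k x * (2 ^ k * (1 / 2) ^ k)
          + (1 / 2) ^ k * (2 ^ k * (1 / 2) ^ k)"
        by (simp add: power2_eq_square algebra_simps)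
      also have "2 ^ k * (1 / 2 :: real) ^ k = 1" by (simp add: power_divide)
      finally show ?thesis using d0[of k x] by simp
    qed
    then have "(\<integral>\<^sup>+x. ennreal (d k x) \<partial>M) \<le> (\<integral>\<^sup>+x. ennreal (2 ^ k * (d k x)\<^sup>2 + (1 / 2) ^ k) \<partial>M)"
      by (intro nn_integral_mono ennreal_leI)
    also have "\<dots> = ennreal (\<integral>x. 2 ^ k * (d k x)\<^sup>2 + (1 / 2) ^ k \<partial>M)"
      by (rule nn_integral_eq_integral) (auto simp: int)
    also have "(\<integral>x. 2 ^ k * (d k x)\<^sup>2 + (1 / 2) ^ k \<partial>M)
        = 2 ^ k * (\<integral>x. (d k x)\<^sup>2 \<partial>M) + (1 / 2) ^ k * measure M (space M)"
      by (simp add: int)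
    also have "2 ^ k * (\<integral>x. (d k x)\<^sup>2 \<partial>M) \<le> 2 ^ k * (1 / 4) ^ k"
      using fast by (intro mult_left_mono) (simp_all add: d_def)
    also have "2 ^ k * (1 / 4 :: real) ^ k = (1 / 2) ^ k"
      by (simp flip: power_mult_distrib)
    finally show ?thesis by (simp add: C_def algebra_simps ennreal_leI)
  qed
  have "summable (\<lambda>k. C * (1 / 2) ^ k)" by (intro summable_mult summable_geometric) simp
  have "(\<integral>\<^sup>+x. (\<Sum>k. ennreal (d k x)) \<partial>M) = (\<Sum>k. \<integral>\<^sup>+x. ennreal (d k x) \<partial>M)"
    by (rule nn_integral_suminf) measurable
  also have "\<dots> \<le> (\<Sum>k. ennreal (C * (1 / 2) ^ k))" by (intro suminf_le bound) simp_all
  also have "\<dots> = ennreal (\<Sum>k. C * (1 / 2) ^ k)"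
    by (rule suminf_ennreal2) (use \<open>summable _\<close> in \<open>simp_all add: C_def\<close>)
  also have "\<dots> < \<infinity>" by simp
  finally have "AE x in M. (\<Sum>k. ennreal (d k x)) \<noteq> \<infinity>"
    by (intro nn_integral_PInf_AE) auto
  then show ?thesis
  proof eventually_elim
    case (elim x)
    then have "summable (\<lambda>k. d k x)" by (intro summable_suminf_not_top) (simp_all add: d0)
    then have "summable (\<lambda>k. g (Suc k) x - g k x)"
      unfolding d_def by (rule summable_norm_cancel)
    then have "convergent (\<lambda>n. (\<Sum>k<n. g (Suc k) x - g k x) + g 0 x)"
      by (intro convergent_add convergent_const) (simp add: summable_iff_convergent)
    moreover have "(\<lambda>n. (\<Sum>k<n. g (Suc k) x - g k x) + g 0 x) = (\<lambda>n. g n x)"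
      using sum_lessThan_telescope[of "\<lambda>k. g k x"] by (simp add: fun_eq_iff)
    ultimately show ?case by simp
  qed
qed

text \<open>The limit is taken pointwise along a rapidly convergent subsequence. Fatou's lemma then
  bounds its distance to \<open>f n\<close> for every late n, not only for members of the
  subsequence.\<close>

lemma Riesz_Fischer:
  fixes f :: "nat \<Rightarrow> 'a \<Rightarrow> complex"
  assumes "finite_measure M" and f: "\<And>n. f n \<in> sq_integrable M"
    and cauchy: "\<And>e. 0 < e \<Longrightarrow> \<exists>N. \<forall>m\<ge>N. \<forall>n\<ge>N. (\<integral>x. (cmod (f m x - f n x))\<^sup>2 \<partial>M) < e"
  obtains g where "g \<in> sq_integrable M" "(\<lambda>n. \<integral>x. (cmod (f n x - g x))\<^sup>2 \<partial>M) \<longlonglongrightarrow> 0"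
proof -
  interpret finite_measure M by fact
  have [measurable]: "f k \<in> borel_measurable M" for k using f by (simp add: sq_integrable_iff)
  have "\<exists>N. \<forall>m\<ge>N. \<forall>n\<ge>N. (\<integral>x. (cmod (f m x - f n x))\<^sup>2 \<partial>M) < (1 / 4) ^ k" for k
    by (rule cauchy) simp
  then obtain N where N: "\<And>k m n. m \<ge> N k \<Longrightarrow> n \<ge> N k \<Longrightarrow>
      (\<integral>x. (cmod (f m x - f n x))\<^sup>2 \<partial>M) < (1 / 4) ^ k" by metis
  \<comment> \<open>N need not be monotone; adding up all \<open>N i\<close> makes r nondecreasing
    with \<open>r k\<close> at least \<open>N k\<close>, and the summand k makes it at least
    k.\<close>
  define r where "r k = k + (\<Sum>i\<le>k. N i)" for k
  have rN: "N k \<le> r k" for k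
    unfolding r_def by (metis atMost_iff finite_atMost member_le_sum order_refl trans_le_add2 zero_le)
  have r: "k \<le> r k" "r k \<le> r (Suc k)" for k by (simp_all add: r_def)
  have "AE x in M. convergent (\<lambda>k. f (r k) x)"
  proof (rule AE_convergent_if_fast_Cauchy[OF \<open>finite_measure M\<close> f])
    show "(\<integral>x. (cmod (f (r (Suc k)) x - f (r k) x))\<^sup>2 \<partial>M) \<le> (1 / 4) ^ k" for k
      using N[of k "r (Suc k)" "r k"] rN[of k] r[of k] by simp
  qed
  \<comment> \<open>\<open>lim\<close> is total, so g is defined and measurable on the whole space;
    divergence occurs on a null set only.\<close>
  define g where "g x = lim (\<lambda>k. f (r k) x)" for x
  have [measurable]: "g \<in> borel_measurable M" unfolding g_def by measurable
  have lim: "AE x in M. (\<lambda>k. f (r k) x) \<longlonglongrightarrow> g x"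
    using \<open>AE x in M. convergent _\<close> by eventually_elim (simp add: g_def convergent_LIMSEQ_iff)
  have bound: "(\<lambda>x. f n x - g x) \<in> sq_integrable M \<and> (\<integral>x. (cmod (f n x - g x))\<^sup>2 \<partial>M) \<le> e"
    if e: "0 < e" and n: "\<And>m. m \<ge> n \<Longrightarrow> (\<integral>x. (cmod (f n x - f m x))\<^sup>2 \<partial>M) < e" for n e
  proof -
    have "(\<integral>\<^sup>+x. ennreal ((cmod (f n x - g x))\<^sup>2) \<partial>M)
        = (\<integral>\<^sup>+x. liminf (\<lambda>k. ennreal ((cmod (f n x - f (r k) x))\<^sup>2)) \<partial>M)"
    proof (rule nn_integral_cong_AE, use lim in eventually_elim)
      fix x assume "(\<lambda>k. f (r k) x) \<longlonglongrightarrow> g x"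
      then have "(\<lambda>k. ennreal ((cmod (f n x - f (r k) x))\<^sup>2)) \<longlonglongrightarrow> ennreal ((cmod (f n x - g x))\<^sup>2)"
        by (intro tendsto_intros)
      from lim_imp_Liminf[OF _ this]
      show "ennreal ((cmod (f n x - g x))\<^sup>2) = liminf (\<lambda>k. ennreal ((cmod (f n x - f (r k) x))\<^sup>2))"
        by simp
    qed
    also have "\<dots> \<le> liminf (\<lambda>k. \<integral>\<^sup>+x. ennreal ((cmod (f n x - f (r k) x))\<^sup>2) \<partial>M)"
      by (rule nn_integral_liminf) measurable
    also have "\<dots> \<le> liminf (\<lambda>k. ennreal e)"
    proof (rule Liminf_mono, rule eventually_sequentiallyI[of n])
      fix k assume "n \<le> k"
      then have "(\<integral>x. (cmod (f n x - f (r k) x))\<^sup>2 \<partial>M) \<le> e" using n[of "r k"] r(1)[of k] by simp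
      then show "(\<integral>\<^sup>+x. ennreal ((cmod (f n x - f (r k) x))\<^sup>2) \<partial>M) \<le> ennreal e"
        by (simp add: nn_integral_eq_sq sq_integrable_diff f ennreal_leI)
    qed
    also have "\<dots> = ennreal e" by (simp add: Liminf_const)
    finally have le: "(\<integral>\<^sup>+x. ennreal ((cmod (f n x - g x))\<^sup>2) \<partial>M) \<le> ennreal e" .
    then have "integrable M (\<lambda>x. (cmod (f n x - g x))\<^sup>2)"
      by (intro integrableI_bounded) (auto simp: le_less_trans)
    then have sq: "(\<lambda>x. f n x - g x) \<in> sq_integrable M" by (simp add: sq_integrable_iff)
    then show ?thesis using le e by (simp add: nn_integral_eq_sq)
  qed
  obtain n where n: "\<forall>m\<ge>n. \<forall>k\<ge>n. (\<integral>x. (cmod (f m x - f k x))\<^sup>2 \<partial>M) < 1"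
    using cauchy[of 1] by auto
  have "(\<lambda>x. f n x - g x) \<in> sq_integrable M" using bound[of 1 n] n by auto
  from sq_integrable_diff[OF f[of n] this] have "g \<in> sq_integrable M" by simp
  moreover have "(\<lambda>n. \<integral>x. (cmod (f n x - g x))\<^sup>2 \<partial>M) \<longlonglongrightarrow> 0"
  proof (rule LIMSEQ_I)
    fix e :: real assume e: "0 < e"
    obtain n where n: "\<forall>m\<ge>n. \<forall>k\<ge>n. (\<integral>x. (cmod (f m x - f k x))\<^sup>2 \<partial>M) < e / 2"
      using cauchy[of "e / 2"] e by auto
    have "norm ((\<integral>x. (cmod (f m x - g x))\<^sup>2 \<partial>M) - 0) < e" if "m \<ge> n" for m
      using bound[of "e / 2" m] n that e by auto
    then show "\<exists>N. \<forall>m\<ge>N. norm ((\<integral>x. (cmod (f m x - g x))\<^sup>2 \<partial>M) - 0) < e" by blast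
  qed
  ultimately show thesis by (rule that)
qed

section \<open>Classes of square integrable functions\<close>

lemma equiv_ae_rel: "equiv (sq_integrable M) (ae_rel M)"
proof (rule equivI)
  show "ae_rel M \<subseteq> sq_integrable M \<times> sq_integrable M" by (auto simp: ae_rel_def)
  show "refl_on (sq_integrable M) (ae_rel M)" by (auto simp: refl_on_def ae_rel_def)
  show "sym (ae_rel M)" by (auto simp: sym_def ae_rel_def elim: eventually_mono)
  show "trans (ae_rel M)" by (rule transI) (auto simp: ae_rel_def elim: eventually_elim2)
qed

lemma l2_class_mem [simp]: "f \<in> sq_integrable M \<Longrightarrow> l2_class M f \<in> hcarrier (L2 M)"
  by (simp add: L2_def l2_class_def quotientI)

lemma L2_cases:
  assumes "X \<in> hcarrier (L2 M)"
  obtains f where "f \<in> sq_integrable M" "X = l2_class M f"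
  using assms by (auto simp: L2_def l2_class_def elim: quotientE)

lemma l2_class_eq_iff:
  "f \<in> sq_integrable M \<Longrightarrow> g \<in> sq_integrable M \<Longrightarrow>
    l2_class M f = l2_class M g \<longleftrightarrow> (AE x in M. f x = g x)"
  unfolding l2_class_def
  by (subst eq_equiv_class_iff[OF equiv_ae_rel]) (auto simp: ae_rel_def)

text \<open>A class is nonempty, so \<open>SOME\<close> picks one of its members. With this the
  operations of \<open>L2\<close>, defined through chosen representatives, can be computed with any
  representatives.\<close>

lemma l2_rep_class:
  assumes "f \<in> sq_integrable M"
  shows l2_rep_sq_integrable: "l2_rep (l2_class M f) \<in> sq_integrable M"
    and l2_rep_AE: "AE x in M. l2_rep (l2_class M f) x = f x"
proof -
  have "f \<in> l2_class M f" using assms by (simp add: l2_class_def ae_rel_def)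
  then have "l2_rep (l2_class M f) \<in> l2_class M f" unfolding l2_rep_def by (rule someI[where P = "\<lambda>g. g \<in> _"])
  then show "l2_rep (l2_class M f) \<in> sq_integrable M" "AE x in M. l2_rep (l2_class M f) x = f x"
    by (auto simp: l2_class_def ae_rel_def elim: eventually_mono)
qed

lemma hadd_L2:
  assumes f: "f \<in> sq_integrable M" and g: "g \<in> sq_integrable M"
  shows "hadd (L2 M) (l2_class M f) (l2_class M g) = l2_class M (\<lambda>x. f x + g x)"
proof -
  have "AE x in M. l2_rep (l2_class M f) x + l2_rep (l2_class M g) x = f x + g x"
    using l2_rep_AE[OF f] l2_rep_AE[OF g] by eventually_elim simp
  then show ?thesis
    by (simp add: L2_def l2_class_eq_iff sq_integrable_add l2_rep_sq_integrable f g)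
qed

text \<open>Serves scalar multiples, where m is constant, as well as multiplication by the
  coordinates.\<close>

lemma l2_class_rep_mult:
  assumes f: "f \<in> sq_integrable M" and m: "m \<in> borel_measurable M"
    and mf: "(\<lambda>x. m x * f x) \<in> sq_integrable M"
  shows "l2_class M (\<lambda>x. m x * l2_rep (l2_class M f) x) = l2_class M (\<lambda>x. m x * f x)"
proof -
  have AE: "AE x in M. m x * f x = m x * l2_rep (l2_class M f) x"
    using l2_rep_AE[OF f] by eventually_elim simp
  have [measurable]: "l2_rep (l2_class M f) \<in> borel_measurable M" "m \<in> borel_measurable M"
    using l2_rep_sq_integrable[OF f] m by (simp_all add: sq_integrable_iff)
  have "(\<lambda>x. m x * l2_rep (l2_class M f) x) \<in> sq_integrable M"
    by (rule sq_integrable_cong_AE[OF mf _ AE]) measurable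
  then show ?thesis using l2_class_eq_iff[OF mf, of "\<lambda>x. m x * l2_rep (l2_class M f) x"] AE by simp
qed

lemma hscale_L2:
  "f \<in> sq_integrable M \<Longrightarrow> hscale (L2 M) c (l2_class M f) = l2_class M (\<lambda>x. c * f x)"
  using l2_class_rep_mult[of f M "\<lambda>_. c"] by (simp add: L2_def sq_integrable_scale)

lemma hdiff_L2:
  "f \<in> sq_integrable M \<Longrightarrow> g \<in> sq_integrable M \<Longrightarrow>
    hdiff (L2 M) (l2_class M f) (l2_class M g) = l2_class M (\<lambda>x. f x - g x)"
  using hadd_L2[of f M "\<lambda>x. (- 1) * g x"] sq_integrable_scale[of g M "- 1"]
  by (simp add: hdiff_def hscale_L2)

lemma hinner_L2:
  assumes f: "f \<in> sq_integrable M" and g: "g \<in> sq_integrable M"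
  shows "hinner (L2 M) (l2_class M f) (l2_class M g) = (\<integral>x. f x * cnj (g x) \<partial>M)"
proof -
  have [measurable]: "f \<in> borel_measurable M" "g \<in> borel_measurable M"
    "l2_rep (l2_class M f) \<in> borel_measurable M" "l2_rep (l2_class M g) \<in> borel_measurable M"
    using l2_rep_sq_integrable[OF f] l2_rep_sq_integrable[OF g] f g by (simp_all add: sq_integrable_iff)
  have "(\<integral>x. l2_rep (l2_class M f) x * cnj (l2_rep (l2_class M g) x) \<partial>M) = (\<integral>x. f x * cnj (g x) \<partial>M)"
  proof (rule integral_cong_AE)
    show "AE x in M. l2_rep (l2_class M f) x * cnj (l2_rep (l2_class M g) x) = f x * cnj (g x)"
      using l2_rep_AE[OF f] l2_rep_AE[OF g] by eventually_elim simp
  qed measurable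
  then show ?thesis by (simp add: L2_def)
qed

lemma hinner_L2_self:
  assumes f: "f \<in> sq_integrable M"
  shows "hinner (L2 M) (l2_class M f) (l2_class M f) = complex_of_real (\<integral>x. (cmod (f x))\<^sup>2 \<partial>M)"
  by (simp only: hinner_L2[OF f f] complex_norm_square[symmetric] integral_complex_of_real)

lemma hdist_L2:
  assumes "f \<in> sq_integrable M" "g \<in> sq_integrable M"
  shows "hdist (L2 M) (l2_class M f) (l2_class M g) = sqrt (\<integral>x. (cmod (f x - g x))\<^sup>2 \<partial>M)"
  using assms by (simp add: hnorm_def hdiff_L2 hinner_L2_self sq_integrable_diff)

lemma pre_hilbert_L2: "pre_hilbert (L2 M)"
proof unfold_locales
  have "(\<lambda>_. 0) \<in> sq_integrable M" by (simp add: sq_integrable_iff)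
  then show "hcarrier (L2 M) \<noteq> {}" using l2_class_mem by blast
  fix X Y Z c
  assume "X \<in> hcarrier (L2 M)"
  then obtain f where f: "f \<in> sq_integrable M" "X = l2_class M f" by (rule L2_cases)
  show "hscale (L2 M) c X \<in> hcarrier (L2 M)" using f by (simp add: hscale_L2 sq_integrable_scale)
  show "0 \<le> Re (hinner (L2 M) X X)" using f by (simp add: hinner_L2_self)
  assume "Y \<in> hcarrier (L2 M)"
  then obtain g where g: "g \<in> sq_integrable M" "Y = l2_class M g" by (rule L2_cases)
  show "hadd (L2 M) X Y \<in> hcarrier (L2 M)" using f g by (simp add: hadd_L2 sq_integrable_add)
  show "hinner (L2 M) (hscale (L2 M) c X) Y = c * hinner (L2 M) X Y"
    using f g by (simp add: hscale_L2 hinner_L2 sq_integrable_scale mult.assoc)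
  show "hinner (L2 M) Y X = cnj (hinner (L2 M) X Y)"
    using f g Bochner_Integration.integral_cnj[of M "\<lambda>x. f x * cnj (g x)"]
    by (simp add: hinner_L2 mult.commute del: Bochner_Integration.integral_cnj)
  show "X = Y" if "hinner (L2 M) (hdiff (L2 M) X Y) (hdiff (L2 M) X Y) = 0"
  proof -
    have d: "(\<lambda>x. f x - g x) \<in> sq_integrable M" using f g by (simp add: sq_integrable_diff)
    have "(\<integral>x. (cmod (f x - g x))\<^sup>2 \<partial>M) = 0"
      using that f g by (simp add: hdiff_L2 hinner_L2_self[OF d])
    then have "AE x in M. (cmod (f x - g x))\<^sup>2 = 0"
      using d by (subst (asm) integral_nonneg_eq_0_iff_AE) (simp_all add: sq_integrable_iff)
    then have "AE x in M. f x = g x" by eventually_elim simp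
    then show ?thesis using f g by (simp add: l2_class_eq_iff)
  qed
  assume "Z \<in> hcarrier (L2 M)"
  then obtain h where h: "h \<in> sq_integrable M" "Z = l2_class M h" by (rule L2_cases)
  show "hinner (L2 M) (hadd (L2 M) X Y) Z = hinner (L2 M) X Z + hinner (L2 M) Y Z"
    using f g h by (simp add: hadd_L2 hinner_L2 sq_integrable_add distrib_right sq_integrable_inner)
qed

lemma hilbert_L2:
  assumes "finite_measure M"
  shows "hilbert (L2 M)"
proof -
  interpret pre_hilbert "L2 M" by (rule pre_hilbert_L2)
  show ?thesis
  proof unfold_locales
    show "hcomplete (L2 M)"
      unfolding hcomplete_def
    proof (intro allI impI)
      fix s :: "nat \<Rightarrow> _" assume s: "\<forall>n. s n \<in> hcarrier (L2 M)"
        and cauchy: "\<forall>e>0. \<exists>N. \<forall>m\<ge>N. \<forall>n\<ge>N. hdist (L2 M) (s m) (s n) < e"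
      have "\<forall>n. \<exists>f. f \<in> sq_integrable M \<and> s n = l2_class M f" using s by (metis L2_cases)
      then obtain f where f: "\<And>n. f n \<in> sq_integrable M" "\<And>n. s n = l2_class M (f n)" by metis
      obtain g where g: "g \<in> sq_integrable M" "(\<lambda>n. \<integral>x. (cmod (f n x - g x))\<^sup>2 \<partial>M) \<longlonglongrightarrow> 0"
      proof (rule Riesz_Fischer[OF assms f(1)])
        fix e :: real assume "0 < e"
        then obtain N where "\<forall>m\<ge>N. \<forall>n\<ge>N. hdist (L2 M) (s m) (s n) < sqrt e"
          using cauchy by (meson real_sqrt_gt_zero)
        then show "\<exists>N. \<forall>m\<ge>N. \<forall>n\<ge>N. (\<integral>x. (cmod (f m x - f n x))\<^sup>2 \<partial>M) < e"
          by (intro exI[of _ N]) (simp add: f hdist_L2)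
      qed
      have "(\<lambda>n. hdist (L2 M) (s n) (l2_class M g)) \<longlonglongrightarrow> 0"
        using tendsto_real_sqrt[OF g(2)] by (simp add: f g hdist_L2)
      then show "\<exists>x\<in>hcarrier (L2 M). (\<lambda>n. hdist (L2 M) (s n) x) \<longlonglongrightarrow> 0"
        using g(1) by (intro bexI[of _ "l2_class M g"]) simp_all
    qed
  qed
qed

text \<open>The product of m with its conjugate is 1 almost everywhere and cancels from each inner
  product. The coordinates are such functions on the torus, where \<open>nu p\<close> lives.\<close>

lemma isometry_unimodular_mult:
  assumes m: "m \<in> borel_measurable M" and unimod: "AE x in M. cmod (m x) = 1"
  shows "isometry_on (L2 M) (\<lambda>X. l2_class M (\<lambda>x. m x * l2_rep X x))"
    and "f \<in> sq_integrable M \<Longrightarrow> (\<lambda>x. m x * f x) \<in> sq_integrable M"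
proof -
  show sq: "(\<lambda>x. m x * f x) \<in> sq_integrable M" if f: "f \<in> sq_integrable M" for f
  proof -
    have [measurable]: "f \<in> borel_measurable M" "m \<in> borel_measurable M"
      using f m by (simp_all add: sq_integrable_iff)
    have "AE x in M. (cmod (f x))\<^sup>2 = (cmod (m x * f x))\<^sup>2"
      using unimod by eventually_elim (simp add: norm_mult)
    then have "integrable M (\<lambda>x. (cmod (m x * f x))\<^sup>2)"
      using f by (subst integrable_cong_AE[of _ _ "\<lambda>x. (cmod (f x))\<^sup>2"]) (auto simp: sq_integrable_iff)
    then show ?thesis by (simp add: sq_integrable_iff)
  qed
  have A: "l2_class M (\<lambda>x. m x * l2_rep (l2_class M f) x) = l2_class M (\<lambda>x. m x * f x)"
    if "f \<in> sq_integrable M" for f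
    by (rule l2_class_rep_mult[OF that m sq[OF that]])
  show "isometry_on (L2 M) (\<lambda>X. l2_class M (\<lambda>x. m x * l2_rep X x))"
    unfolding isometry_on_def
  proof (intro conjI ballI allI)
    fix X c assume "X \<in> hcarrier (L2 M)"
    then obtain f where f: "f \<in> sq_integrable M" "X = l2_class M f" by (rule L2_cases)
    show "l2_class M (\<lambda>x. m x * l2_rep X x) \<in> hcarrier (L2 M)" using f by (simp add: A sq)
    show "l2_class M (\<lambda>x. m x * l2_rep (hscale (L2 M) c X) x) =
        hscale (L2 M) c (l2_class M (\<lambda>x. m x * l2_rep X x))"
      using f by (simp add: A sq hscale_L2 sq_integrable_scale mult.left_commute)
  next
    fix X Y assume "X \<in> hcarrier (L2 M)" "Y \<in> hcarrier (L2 M)"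
    then obtain f g where f: "f \<in> sq_integrable M" "X = l2_class M f"
      and g: "g \<in> sq_integrable M" "Y = l2_class M g" by (meson L2_cases)
    show "l2_class M (\<lambda>x. m x * l2_rep (hadd (L2 M) X Y) x) =
        hadd (L2 M) (l2_class M (\<lambda>x. m x * l2_rep X x)) (l2_class M (\<lambda>x. m x * l2_rep Y x))"
      using f g by (simp add: A sq hadd_L2 sq_integrable_add distrib_left)
    have [measurable]: "f \<in> borel_measurable M" "g \<in> borel_measurable M" "m \<in> borel_measurable M"
      using f g m by (simp_all add: sq_integrable_iff)
    have "(\<integral>x. m x * f x * cnj (m x * g x) \<partial>M) = (\<integral>x. f x * cnj (g x) \<partial>M)"
    proof (rule integral_cong_AE)
      show "AE x in M. m x * f x * cnj (m x * g x) = f x * cnj (g x)"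
        using unimod
      proof eventually_elim
        case (elim x)
        then have "m x * cnj (m x) = 1" by (simp flip: complex_norm_square)
        moreover have "m x * f x * cnj (m x * g x) = (m x * cnj (m x)) * (f x * cnj (g x))"
          by simp
        ultimately show ?case by simp
      qed
    qed measurable
    then show "hinner (L2 M) (l2_class M (\<lambda>x. m x * l2_rep X x)) (l2_class M (\<lambda>x. m x * l2_rep Y x)) =
        hinner (L2 M) X Y"
      using f g by (simp add: A sq hinner_L2)
  qed
qed

section \<open>Fourier analysis on the torus and the space \<open>P\<^sup>2(\<nu>\<^sub>p)\<close>\<close>

lemma measurable_circle_param:
  "(\<lambda>t. cis (2 * pi * t)) \<in> measurable (uniform_measure lborel {0..1}) (restrict_space borel (sphere 0 1))"
proof (rule measurable_restrict_space2)
  have "(\<lambda>t :: real. cis (2 * pi * t)) \<in> borel_measurable borel"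
    by (intro borel_measurable_continuous_onI continuous_intros)
  then show "(\<lambda>t. cis (2 * pi * t)) \<in> borel_measurable (uniform_measure lborel {0..1})"
    by (simp add: uniform_measure_def)
qed simp

lemma finite_measure_circle_haar: "finite_measure circle_haar"
proof -
  have "emeasure lborel {0..1 :: real} = 1" by simp
  then have "emeasure (uniform_measure lborel {0..1 :: real}) (space lborel) = 1"
    by (subst emeasure_uniform_measure) simp_all
  then have "finite_measure (uniform_measure lborel {0..1 :: real})"
    by (intro finite_measureI) simp
  then show ?thesis
    unfolding circle_haar_def
    by (rule finite_measure.finite_measure_distr) (rule measurable_circle_param)
qed

lemma space_circle_haar: "space circle_haar = sphere 0 1"
  by (simp add: circle_haar_def space_restrict_space)

lemma sets_circle_haar: "sets circle_haar = sets (restrict_space borel (sphere 0 1))"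
  by (simp add: circle_haar_def)

lemma borel_measurable_circle [measurable]: "(\<lambda>z. z) \<in> borel_measurable circle_haar"
  by (subst measurable_cong_sets[OF sets_circle_haar refl]) (simp add: measurable_restrict_space1)

lemma integral_circle_haar:
  assumes "f \<in> borel_measurable borel"
  shows "(\<integral>z. f z \<partial>circle_haar) = (\<integral>t. indicator {0..1} t *\<^sub>R (f (cis (2 * pi * t)) :: complex) \<partial>lborel)"
proof -
  have [measurable]: "f \<in> borel_measurable borel" by fact
  have "f \<in> borel_measurable (restrict_space borel (sphere 0 1))"
    by (rule measurable_restrict_space1) measurable
  then have "(\<integral>z. f z \<partial>circle_haar) = (\<integral>t. f (cis (2 * pi * t)) \<partial>uniform_measure lborel {0..1})"
    unfolding circle_haar_def by (rule integral_distr[OF measurable_circle_param])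
  \<comment> \<open>The interval has length 1, so no normalizing factor remains in the
    density.\<close>
  also have "uniform_measure lborel {0..1 :: real} = density lborel (\<lambda>t. ennreal (indicator {0..1} t))"
    unfolding uniform_measure_def by (rule density_cong) (auto split: split_indicator)
  also have "(\<integral>t. f (cis (2 * pi * t)) \<partial>\<dots>) = (\<integral>t. indicator {0..1} t *\<^sub>R f (cis (2 * pi * t)) \<partial>lborel)"
  proof (rule integral_density)
    have "(\<lambda>t :: real. cis (2 * pi * t)) \<in> borel_measurable borel"
      by (intro borel_measurable_continuous_onI continuous_intros)
    then show "(\<lambda>t. f (cis (2 * pi * t))) \<in> borel_measurable lborel" by measurable
  qed simp_all
  finally show ?thesis .
qed

text \<open>On the parameter interval the integrand is \<open>cis (2 * pi * n * t)\<close> with n =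
  j - l, a real number so that j < l is allowed. For n distinct from 0 it has the antiderivative F,
  which takes the same value at 0 and 1.\<close>

lemma circle_orthonormal: "(\<integral>z. z ^ j * cnj (z ^ l) \<partial>circle_haar) = (if j = l then 1 else 0)"
proof -
  define n where "n = real j - real l"
  have "cis (2 * pi * t) ^ j * cnj (cis (2 * pi * t) ^ l) = cis (2 * pi * n * t)" for t
    by (simp add: Complex.DeMoivre cis_cnj cis_mult n_def algebra_simps)
  then have eq: "(\<integral>z. z ^ j * cnj (z ^ l) \<partial>circle_haar)
      = (\<integral>t. indicator {0..1} t *\<^sub>R cis (2 * pi * n * t) \<partial>lborel)"
    by (subst integral_circle_haar) simp_all
  show ?thesis
  proof (cases "j = l")
    case True
    then show ?thesis unfolding eq by (simp add: n_def)
  next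
    case False
    then have n: "n \<noteq> 0" by (simp add: n_def)
    define F where "F t = cis (2 * pi * n * t) / (\<i> * complex_of_real (2 * pi * n))" for t
    have "(\<integral>t. indicator {0..1} t *\<^sub>R cis (2 * pi * n * t) \<partial>lborel) = F 1 - F 0"
    proof (rule integral_FTC_Icc)
      fix t :: real
      have "((\<lambda>t. exp (\<i> * complex_of_real (2 * pi * n) * of_real t) / (\<i> * complex_of_real (2 * pi * n)))
          has_vector_derivative exp (\<i> * complex_of_real (2 * pi * n) * of_real t)) (at t within {0..1})"
        using n by (auto intro!: derivative_eq_intros has_vector_derivative_real_field)
      then show "(F has_vector_derivative cis (2 * pi * n * t)) (at t within {0..1})"
        by (simp add: F_def[abs_def] cis_conv_exp mult.assoc)
    qed (auto intro!: continuous_intros)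
    also have "F 1 = F 0"
    proof -
      have "cis (2 * pi * (real j - real l)) = cis (2 * pi * real j) * cnj (cis (2 * pi * real l))"
        by (simp add: cis_cnj cis_mult algebra_simps)
      then have "cis (2 * pi * n) = 1" by (simp add: n_def cis_multiple_2pi)
      then show ?thesis by (simp add: F_def)
    qed
    finally show ?thesis using False eq by simp
  qed
qed

lemma finite_measure_torus_haar: "finite_measure torus_haar"
proof -
  interpret finite_measure circle_haar by (rule finite_measure_circle_haar)
  show ?thesis unfolding torus_haar_def
    by (rule finite_measure_pair_measure) unfold_locales
qed

lemma space_torus_haar: "space torus_haar = sphere 0 1 \<times> sphere 0 1"
  by (simp add: torus_haar_def space_pair_measure space_circle_haar)

lemma measurable_torus [measurable]:
  "fst \<in> borel_measurable torus_haar" "snd \<in> borel_measurable torus_haar"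
  unfolding torus_haar_def
  using measurable_compose[OF measurable_fst borel_measurable_circle]
    measurable_compose[OF measurable_snd borel_measurable_circle] by simp_all

lemma measurable_mon [measurable]: "mon k \<in> borel_measurable torus_haar"
  unfolding mon_def[abs_def] by measurable

lemma cmod_mon_torus: "x \<in> space torus_haar \<Longrightarrow> cmod (mon k x) = 1"
  by (auto simp: space_torus_haar mon_def norm_mult norm_power)

lemma integrable_mon: "integrable torus_haar (\<lambda>x. mon k x * cnj (mon l x))"
proof -
  interpret finite_measure torus_haar by (rule finite_measure_torus_haar)
  show ?thesis by (rule integrable_const_bound[of _ 1]) (simp_all add: norm_mult cmod_mon_torus)
qed

lemma torus_orthonormal: "(\<integral>x. mon k x * cnj (mon l x) \<partial>torus_haar) = (if k = l then 1 else 0)"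
proof -
  interpret finite_measure circle_haar by (rule finite_measure_circle_haar)
  interpret pair_sigma_finite circle_haar circle_haar ..
  have "(\<integral>x. mon k x * cnj (mon l x) \<partial>torus_haar)
      = (\<integral>z. \<integral>w. mon k (z, w) * cnj (mon l (z, w)) \<partial>circle_haar \<partial>circle_haar)"
    unfolding torus_haar_def by (rule integral_fst'[symmetric]) (rule integrable_mon[unfolded torus_haar_def])
  also have "\<dots> = (\<integral>z. (z ^ fst k * cnj (z ^ fst l)) * (\<integral>w. w ^ snd k * cnj (w ^ snd l) \<partial>circle_haar) \<partial>circle_haar)"
    by (simp add: mon_def ac_simps flip: integral_mult_right_zero)
  also have "\<dots> = (if k = l then 1 else 0)"
    unfolding circle_orthonormal by (simp add: circle_orthonormal[unfolded complex_cnj_power] prod_eq_iff)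
  finally show ?thesis .
qed

lemma measurable_bieval [measurable]: "bieval p \<in> borel_measurable torus_haar"
  by (subst bieval_eq_sum[OF finite_cf_support order_refl, abs_def]) measurable

text \<open>Monomials have modulus 1 on the torus. The bound makes the density of
  \<open>nu p\<close> integrable and polynomials square integrable.\<close>

lemma cmod_bieval_le: "x \<in> space torus_haar \<Longrightarrow> cmod (bieval p x) \<le> (\<Sum>k | cf p k \<noteq> 0. cmod (cf p k))"
  unfolding bieval_eq_sum[OF finite_cf_support order_refl]
  by (rule sum_norm_le) (simp add: norm_mult cmod_mon_torus)

text \<open>Both polynomials are expanded over one finite index set, and orthonormality leaves the
  diagonal. This is the only link between integrals over the torus and Taylor coefficients in the
  bidisc.\<close>

lemma Parseval:
  "(\<integral>x. bieval p x * cnj (bieval q x) \<partial>torus_haar) = hinner hardy2 (hardy_poly p) (hardy_poly q)"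
proof -
  define F where "F = {k. cf p k \<noteq> 0} \<union> {k. cf q k \<noteq> 0}"
  have F: "finite F" "{k. cf p k \<noteq> 0} \<subseteq> F" "{k. cf q k \<noteq> 0} \<subseteq> F"
    "{k. cf p k \<noteq> 0} \<inter> {k. cf q k \<noteq> 0} \<subseteq> F"
    by (auto simp: F_def finite_cf_support)
  have "bieval p x * cnj (bieval q x)
      = (\<Sum>k\<in>F. \<Sum>l\<in>F. (cf p k * cnj (cf q l)) * (mon k x * cnj (mon l x)))" for x
    by (simp add: bieval_eq_sum[OF F(1,2)] bieval_eq_sum[OF F(1,3)] sum_product ac_simps)
  then have "(\<integral>x. bieval p x * cnj (bieval q x) \<partial>torus_haar)
      = (\<Sum>k\<in>F. \<Sum>l\<in>F. (cf p k * cnj (cf q l)) * (if k = l then 1 else 0))"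
    by (simp add: integrable_mon flip: torus_orthonormal)
  also have "\<dots> = hinner hardy2 (hardy_poly p) (hardy_poly q)"
    unfolding hinner_hardy_poly[OF F(1,4)] by (intro sum.cong) (simp_all add: F(1) if_distrib cong: if_cong)
  finally show ?thesis .
qed

lemma torus_norm_sq: "complex_of_real ((torus_norm p)\<^sup>2) = hinner hardy2 (hardy_poly p) (hardy_poly p)"
proof -
  have "0 \<le> (\<integral>x. (cmod (bieval p x))\<^sup>2 \<partial>torus_haar)" by simp
  then have "complex_of_real ((torus_norm p)\<^sup>2) = (\<integral>x. complex_of_real ((cmod (bieval p x))\<^sup>2) \<partial>torus_haar)"
    by (simp only: torus_norm_def real_sqrt_pow2 integral_complex_of_real)
  then show ?thesis by (simp only: complex_norm_square Parseval)
qed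

text \<open>The inner product is a sum of squared moduli of coefficients. Used for positivity of
  \<open>torus_norm p\<close>, and in (iv) for the product of the extreme components.\<close>

lemma hardy_poly_inner_self_eq_0:
  assumes "hinner hardy2 (hardy_poly p) (hardy_poly p) = 0"
  shows "p = 0"
proof -
  let ?F = "{k. cf p k \<noteq> 0}"
  have "complex_of_real (\<Sum>k\<in>?F. (cmod (cf p k))\<^sup>2) = hinner hardy2 (hardy_poly p) (hardy_poly p)"
    by (simp add: hinner_hardy_poly[OF finite_cf_support[of p]] complex_norm_square del: of_real_power)
  then have "(\<Sum>k\<in>?F. (cmod (cf p k))\<^sup>2) = 0" unfolding assms by (simp only: of_real_eq_0_iff)
  then have "?F = {}" using finite_cf_support[of p] by (auto simp: sum_nonneg_eq_0_iff)
  then show ?thesis by (auto simp: cf_eq_iff fun_eq_iff)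
qed

lemma torus_norm_pos: "p \<noteq> 0 \<Longrightarrow> 0 < torus_norm p"
  using torus_norm_sq[of p] hardy_poly_inner_self_eq_0[of p]
  by (cases "torus_norm p = 0") (auto simp: torus_norm_def less_le)

lemma bieval_add: "bieval (p + q) x = bieval p x + bieval q x"
  by (simp add: bieval_def split: prod.split)

lemma bieval_mult: "bieval (p * q) x = bieval p x * bieval q x"
  by (simp add: bieval_def split: prod.split)

lemma bieval_smult: "bieval (smult [:c:] p) x = c * bieval p x"
  by (simp add: bieval_def split: prod.split)

lemma bieval_z: "bieval [:[:0, 1:]:] x = fst x"
  by (simp add: bieval_def split: prod.split)

lemma bieval_w: "bieval [:0, 1:] x = snd x"
  by (simp add: bieval_def split: prod.split)

section \<open>The weighted measure and multiplication by the coordinates\<close>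

lemma space_nu: "space (nu p) = space torus_haar"
  by (simp add: nu_def)

lemma measurable_nu: "borel_measurable (nu p) = borel_measurable torus_haar"
  by (rule measurable_cong_sets) (simp_all add: nu_def)

lemma integral_nu:
  assumes "f \<in> borel_measurable torus_haar"
  shows "(\<integral>x. f x \<partial>nu p) = (\<integral>x. ((cmod (bieval p x))\<^sup>2 / (torus_norm p)\<^sup>2) *\<^sub>R (f x :: complex) \<partial>torus_haar)"
  unfolding nu_def by (rule integral_density) (use assms in simp_all)

lemma finite_measure_nu: "finite_measure (nu p)"
proof -
  interpret finite_measure torus_haar by (rule finite_measure_torus_haar)
  have "AE x in torus_haar. norm ((cmod (bieval p x))\<^sup>2 / (torus_norm p)\<^sup>2)
      \<le> (\<Sum>k | cf p k \<noteq> 0. cmod (cf p k))\<^sup>2 / (torus_norm p)\<^sup>2"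
    by (rule AE_I2) (simp add: divide_right_mono power_mono cmod_bieval_le)
  then have "integrable torus_haar (\<lambda>x. (cmod (bieval p x))\<^sup>2 / (torus_norm p)\<^sup>2)"
    by (rule integrable_const_bound) simp
  then have "(\<integral>\<^sup>+x. ennreal ((cmod (bieval p x))\<^sup>2 / (torus_norm p)\<^sup>2) \<partial>torus_haar) < \<infinity>"
    by (subst nn_integral_eq_integral) simp_all
  moreover have "emeasure (nu p) (space (nu p)) =
      (\<integral>\<^sup>+x. ennreal ((cmod (bieval p x))\<^sup>2 / (torus_norm p)\<^sup>2) \<partial>torus_haar)"
    unfolding nu_def by (subst emeasure_density) (auto intro!: nn_integral_cong)
  ultimately show ?thesis by (intro finite_measureI) simp
qed

lemma bieval_sq_integrable [simp]: "bieval h \<in> sq_integrable (nu p)"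
proof -
  interpret finite_measure "nu p" by (rule finite_measure_nu)
  have "AE x in nu p. norm ((cmod (bieval h x))\<^sup>2) \<le> (\<Sum>k | cf h k \<noteq> 0. cmod (cf h k))\<^sup>2"
    by (rule AE_I2) (simp add: space_nu power_mono cmod_bieval_le)
  then have "integrable (nu p) (\<lambda>x. (cmod (bieval h x))\<^sup>2)"
    by (rule integrable_const_bound) (simp add: measurable_nu)
  then show ?thesis by (simp add: sq_integrable_iff measurable_nu)
qed

lemma nu_poly_mem [simp]: "nu_poly p h \<in> hcarrier (L2 (nu p))"
  by (simp add: nu_poly_def)

lemma hinner_nu_poly:
  "hinner (P2 p) (nu_poly p h) (nu_poly p g) =
    complex_of_real (1 / (torus_norm p)\<^sup>2) *
    hinner hardy2 (hardy_poly (p * h)) (hardy_poly (p * g))"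
proof -
  have "hinner (P2 p) (nu_poly p h) (nu_poly p g) = (\<integral>x. bieval h x * cnj (bieval g x) \<partial>nu p)"
    by (simp add: P2_def hsubspace_def nu_poly_def hinner_L2)
  also have "\<dots> = (\<integral>x. ((cmod (bieval p x))\<^sup>2 / (torus_norm p)\<^sup>2) *\<^sub>R (bieval h x * cnj (bieval g x)) \<partial>torus_haar)"
    by (rule integral_nu) measurable
  also have "\<dots> = (\<integral>x. complex_of_real (1 / (torus_norm p)\<^sup>2) *
      (bieval (p * h) x * cnj (bieval (p * g) x)) \<partial>torus_haar)"
  proof (rule Bochner_Integration.integral_cong[OF refl])
    fix x
    \<comment> \<open>The weight splits as p times its conjugate, one factor for each argument of
      the inner product.\<close>
    have "complex_of_real ((cmod (bieval p x))\<^sup>2) = bieval p x * cnj (bieval p x)"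
      by (rule complex_norm_square)
    then show "((cmod (bieval p x))\<^sup>2 / (torus_norm p)\<^sup>2) *\<^sub>R (bieval h x * cnj (bieval g x)) =
        complex_of_real (1 / (torus_norm p)\<^sup>2) * (bieval (p * h) x * cnj (bieval (p * g) x))"
      by (simp add: scaleR_conv_of_real bieval_mult del: of_real_power)
  qed
  also have "\<dots> = complex_of_real (1 / (torus_norm p)\<^sup>2) *
      hinner hardy2 (hardy_poly (p * h)) (hardy_poly (p * g))"
    by (simp only: integral_mult_right_zero Parseval)
  finally show ?thesis .
qed

lemma hadd_nu_poly: "hadd (L2 (nu p)) (nu_poly p h) (nu_poly p g) = nu_poly p (h + g)"
  by (simp add: nu_poly_def hadd_L2 bieval_add[abs_def])

lemma hscale_nu_poly: "hscale (L2 (nu p)) c (nu_poly p h) = nu_poly p (smult [:c:] h)"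
  by (simp add: nu_poly_def hscale_L2 bieval_smult[abs_def])

lemma hadd_hardy_poly: "hadd hardy2 (hardy_poly h) (hardy_poly g) = hardy_poly (h + g)"
  by (simp add: hardy2_def hardy_poly_def bieval_add fun_eq_iff)

lemma hscale_hardy_poly: "hscale hardy2 c (hardy_poly h) = hardy_poly (smult [:c:] h)"
  by (simp add: hardy2_def hardy_poly_def bieval_smult fun_eq_iff)

lemma hilbert_P2: "hilbert (P2 p)"
  unfolding P2_def
  by (rule hilbert.hilbert_hclosure[OF hilbert_L2[OF finite_measure_nu]])
    (auto simp: hadd_nu_poly hscale_nu_poly)

lemma hilbert_principal_submodule: "hilbert (principal_submodule p)"
  unfolding principal_submodule_def
proof (rule hardy2.hilbert_hclosure)
  show "hadd hardy2 x y \<in> range (\<lambda>h. hardy_poly (p * h))"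
    if "x \<in> range (\<lambda>h. hardy_poly (p * h))" "y \<in> range (\<lambda>h. hardy_poly (p * h))" for x y
    using that by (auto simp: hadd_hardy_poly simp flip: distrib_left)
  show "hscale hardy2 c x \<in> range (\<lambda>h. hardy_poly (p * h))"
    if "x \<in> range (\<lambda>h. hardy_poly (p * h))" for x c
    using that by (auto simp: hscale_hardy_poly simp flip: mult_smult_right)
qed auto

text \<open>On classes of polynomials \<open>S_z p\<close> is multiplication by the polynomial z,
  written \<open>[:[:0, 1:]:]\<close>. So \<open>range (nu_poly p)\<close> is invariant and the
  isometry of L^2 restricts to its closure.\<close>

lemma isometry_S_z: "isometry_on (P2 p) (S_z p)"
  and S_z_nu_poly: "S_z p (nu_poly p h) = nu_poly p ([:[:0, 1:]:] * h)"
proof -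
  have m: "fst \<in> borel_measurable (nu p)" by (simp add: measurable_nu)
  have u: "AE x in nu p. cmod (fst x) = 1" by (rule AE_I2) (auto simp: space_nu space_torus_haar)
  have S: "S_z p (nu_poly p h) = nu_poly p ([:[:0, 1:]:] * h)" for h
    unfolding S_z_def nu_poly_def
    by (subst l2_class_rep_mult[OF _ m isometry_unimodular_mult(2)[OF m u]])
      (simp_all only: bieval_sq_integrable bieval_mult[abs_def] bieval_z)
  then show "S_z p (nu_poly p h) = nu_poly p ([:[:0, 1:]:] * h)" .
  show "isometry_on (P2 p) (S_z p)"
    unfolding P2_def
  proof (rule pre_hilbert.isometry_on_hclosure[OF pre_hilbert_L2])
    show "isometry_on (L2 (nu p)) (S_z p)"
      using isometry_unimodular_mult(1)[OF m u] by (simp add: S_z_def[abs_def])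
  qed (auto simp: S simp del: mult_pCons_left)
qed

lemma isometry_S_w: "isometry_on (P2 p) (S_w p)"
  and S_w_nu_poly: "S_w p (nu_poly p h) = nu_poly p ([:0, 1:] * h)"
proof -
  have m: "snd \<in> borel_measurable (nu p)" by (simp add: measurable_nu)
  have u: "AE x in nu p. cmod (snd x) = 1" by (rule AE_I2) (auto simp: space_nu space_torus_haar)
  have S: "S_w p (nu_poly p h) = nu_poly p ([:0, 1:] * h)" for h
    unfolding S_w_def nu_poly_def
    by (subst l2_class_rep_mult[OF _ m isometry_unimodular_mult(2)[OF m u]])
      (simp_all only: bieval_sq_integrable bieval_mult[abs_def] bieval_w)
  then show "S_w p (nu_poly p h) = nu_poly p ([:0, 1:] * h)" .
  show "isometry_on (P2 p) (S_w p)"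
    unfolding P2_def
  proof (rule pre_hilbert.isometry_on_hclosure[OF pre_hilbert_L2])
    show "isometry_on (L2 (nu p)) (S_w p)"
      using isometry_unimodular_mult(1)[OF m u] by (simp add: S_w_def[abs_def])
  qed (auto simp: S simp del: mult_pCons_left)
qed

lemma R_z_hardy_poly: "R_z (hardy_poly h) = hardy_poly ([:[:0, 1:]:] * h)"
  by (simp only: R_z_def hardy_poly_def bieval_mult bieval_z restrict_def fun_eq_iff) simp

lemma R_w_hardy_poly: "R_w (hardy_poly h) = hardy_poly ([:0, 1:] * h)"
  by (simp only: R_w_def hardy_poly_def bieval_mult bieval_w restrict_def fun_eq_iff) simp

text \<open>A coordinate factor is moved past p, so the multiples of p are mapped to multiples of p
  and the isometries of the Hardy space restrict to their closure.\<close>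

lemma isometry_R_principal_submodule:
  "isometry_on (principal_submodule p) R_z" "isometry_on (principal_submodule p) R_w"
proof -
  have "R_z x \<in> range (\<lambda>h. hardy_poly (p * h))" "R_w x \<in> range (\<lambda>h. hardy_poly (p * h))"
    if "x \<in> range (\<lambda>h. hardy_poly (p * h))" for x
    using that by (auto simp: R_z_hardy_poly R_w_hardy_poly mult.left_commute[of _ p] simp del: mult_pCons_left)
  then show "isometry_on (principal_submodule p) R_z" "isometry_on (principal_submodule p) R_w"
    unfolding principal_submodule_def
    by (auto intro!: hardy2.isometry_on_hclosure isometry_R_z isometry_R_w)
qed

section \<open>The unitary \<open>U\<^sub>p\<close>\<close>

definition mult_poly :: "complex poly poly \<Rightarrow> complex poly poly \<Rightarrow> complex \<times> complex \<Rightarrow> complex" where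
  "mult_poly p h = (\<lambda>x\<in>bidisc. bieval p x / complex_of_real (torus_norm p) * bieval h x)"

lemma mult_poly_eq_hardy_poly:
  "mult_poly p h = hardy_poly (p * smult [:1 / complex_of_real (torus_norm p):] h)"
  by (simp add: mult_poly_def hardy_poly_def bieval_mult bieval_smult fun_eq_iff restrict_def
      del: smult_pCons mult_smult_right)

text \<open>Scaling h by ||p|| > 0 is invertible, so the normalization does not change the family as
  a set.\<close>

lemma range_mult_poly:
  assumes "p \<noteq> 0"
  shows "range (mult_poly p) = range (\<lambda>h. hardy_poly (p * h))"
proof (intro equalityI subsetI)
  fix f assume "f \<in> range (\<lambda>h. hardy_poly (p * h))"
  then obtain h where "f = hardy_poly (p * h)" by blast
  then have "f = mult_poly p (smult [:complex_of_real (torus_norm p):] h)"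
    using torus_norm_pos[OF assms] by (simp add: mult_poly_eq_hardy_poly flip: one_pCons)
  then show "f \<in> range (mult_poly p)" by blast
qed (auto simp: mult_poly_eq_hardy_poly simp del: mult_smult_right)

lemma hinner_mult_poly:
  "hinner hardy2 (mult_poly p h) (mult_poly p g) = hinner (P2 p) (nu_poly p h) (nu_poly p g)"
proof -
  have "mult_poly p h = hscale hardy2 (1 / complex_of_real (torus_norm p)) (hardy_poly (p * h))" for h
    by (simp add: mult_poly_eq_hardy_poly hscale_hardy_poly)
  then show ?thesis
    by (simp add: hinner_nu_poly hardy2.inner_expand power2_eq_square)
qed

lemma dense_nu_poly: "range (nu_poly p) \<subseteq> hcarrier (P2 p)" "hclosure (P2 p) (range (nu_poly p)) = hcarrier (P2 p)"
proof -
  interpret L2: pre_hilbert "L2 (nu p)" by (rule pre_hilbert_L2)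
  show "range (nu_poly p) \<subseteq> hcarrier (P2 p)"
    unfolding P2_def hsubspace_simps by (rule L2.hclosure_superset) auto
  show "hclosure (P2 p) (range (nu_poly p)) = hcarrier (P2 p)"
    by (auto simp: P2_def hclosure_def)
qed

lemma dense_mult_poly:
  assumes "p \<noteq> 0"
  shows "range (mult_poly p) \<subseteq> hcarrier (principal_submodule p)"
    and "hclosure (principal_submodule p) (range (mult_poly p)) = hcarrier (principal_submodule p)"
proof -
  show "range (mult_poly p) \<subseteq> hcarrier (principal_submodule p)"
    unfolding principal_submodule_def hsubspace_simps range_mult_poly[OF assms]
    by (rule hardy2.hclosure_superset) auto
  show "hclosure (principal_submodule p) (range (mult_poly p)) = hcarrier (principal_submodule p)"
    by (auto simp: principal_submodule_def hclosure_def range_mult_poly[OF assms])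
qed

text \<open>Both families are indexed by polynomials. That the rule does not depend on the
  polynomial chosen in a class is contained in the equality of the Gram matrices.\<close>

lemma ex_mult_unitary:
  assumes "p \<noteq> 0"
  shows "\<exists>U. extends_mult_unitary p U"
proof -
  have "hinner (P2 p) (nu_poly p h) (nu_poly p g) =
      hinner (principal_submodule p) (mult_poly p h) (mult_poly p g)" for h g
    by (simp add: principal_submodule_def hinner_mult_poly)
  then obtain U where "is_unitary (P2 p) (principal_submodule p) U" "\<And>h. U (nu_poly p h) = mult_poly p h"
    using unitary_extension[OF hilbert_P2 hilbert_principal_submodule dense_nu_poly dense_mult_poly[OF assms]]
    by metis
  then show ?thesis by (auto simp: extends_mult_unitary_def mult_poly_def)
qed

text \<open>On the class of a polynomial h both sides are p z h / ||p||, respectively p w h / ||p||;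
  density does the rest.\<close>

lemma extends_mult_unitary_intertwines:
  assumes ext: "extends_mult_unitary p U" and x: "x \<in> hcarrier (P2 p)"
  shows "U (S_z p x) = R_z (U x)" "U (S_w p x) = R_w (U x)"
proof -
  interpret unitary_pair "P2 p" "principal_submodule p" U
    using ext hilbert_P2 hilbert_principal_submodule
    by (simp add: unitary_pair_def unitary_pair_axioms_def extends_mult_unitary_def)
  have Uh: "U (nu_poly p h) = mult_poly p h" for h
    using ext by (simp add: extends_mult_unitary_def mult_poly_def)
  have z: "U (S_z p x) = R_z (U x)" and w: "U (S_w p x) = R_w (U x)" if "x \<in> range (nu_poly p)" for x
    using that unfolding S_z_nu_poly S_w_nu_poly
    by (auto simp: S_z_nu_poly S_w_nu_poly Uh mult_poly_eq_hardy_poly R_z_hardy_poly R_w_hardy_poly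
        ac_simps simp del: mult_pCons_left mult_pCons_right)
  show "U (S_z p x) = R_z (U x)"
    by (rule intertwine_dense[OF isometry_S_z isometry_R_principal_submodule(1) dense_nu_poly z x])
  show "U (S_w p x) = R_w (U x)"
    by (rule intertwine_dense[OF isometry_S_w isometry_R_principal_submodule(2) dense_nu_poly w x])
qed

lemma hardy_poly_sum_inner_left:
  "hinner hardy2 (hardy_poly (\<Sum>i\<in>I. f i)) (hardy_poly g) = (\<Sum>i\<in>I. hinner hardy2 (hardy_poly (f i)) (hardy_poly g))"
proof (induction I rule: infinite_finite_induct)
  case (insert i I)
  then show ?case by (simp add: hardy2.inner_add_left flip: hadd_hardy_poly)
qed (simp_all add: hinner_hardy2 taylor_hardy_poly)

lemma hardy_poly_sum_inner_right:
  "hinner hardy2 (hardy_poly g) (hardy_poly (\<Sum>i\<in>I. f i)) = (\<Sum>i\<in>I. hinner hardy2 (hardy_poly g) (hardy_poly (f i)))"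
proof (induction I rule: infinite_finite_induct)
  case (insert i I)
  then show ?case by (simp add: hardy2.inner_add_right flip: hadd_hardy_poly)
qed (simp_all add: hinner_hardy2 taylor_hardy_poly)

text \<open>p_r h and p_s g are homogeneous of degrees r + m and s + n, so the full double sum over
  r and s keeps only the pairs with m + r = n + s.\<close>

lemma hinner_nu_poly_homog:
  assumes pc: "\<forall>j\<in>{a..b}. pc j \<in> homog j" and p: "p = (\<Sum>j = a..b. pc j)"
    and h: "h \<in> homog m" and g: "g \<in> homog n"
  shows "hinner (P2 p) (nu_poly p h) (nu_poly p g) =
      complex_of_real (1 / (torus_norm p)\<^sup>2) *
      (\<Sum>(r, s) \<in> {(r, s). a \<le> r \<and> r \<le> b \<and> a \<le> s \<and> s \<le> b \<and> m + r = n + s}.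
         hinner hardy2 (hardy_poly (pc r * h)) (hardy_poly (pc s * g)))"
proof -
  let ?f = "\<lambda>(r, s). hinner hardy2 (hardy_poly (pc r * h)) (hardy_poly (pc s * g))"
  have "hinner hardy2 (hardy_poly (p * h)) (hardy_poly (p * g)) = (\<Sum>x\<in>{a..b} \<times> {a..b}. ?f x)"
    unfolding p sum_distrib_right hardy_poly_sum_inner_left hardy_poly_sum_inner_right
    by (subst sum.swap) (simp add: sum.cartesian_product)
  also have "\<dots> = sum ?f {(r, s). a \<le> r \<and> r \<le> b \<and> a \<le> s \<and> s \<le> b \<and> m + r = n + s}"
  proof (rule sum.mono_neutral_right)
    show "\<forall>x\<in>{a..b} \<times> {a..b} - {(r, s). a \<le> r \<and> r \<le> b \<and> a \<le> s \<and> s \<le> b \<and> m + r = n + s}. ?f x = 0"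
    proof
      fix x assume x: "x \<in> {a..b} \<times> {a..b} - {(r, s). a \<le> r \<and> r \<le> b \<and> a \<le> s \<and> s \<le> b \<and> m + r = n + s}"
      obtain r s where rs: "x = (r, s)" by fastforce
      with x have "pc r * h \<in> homog (r + m)" "pc s * g \<in> homog (s + n)" "r + m \<noteq> s + n"
        using pc h g by (auto intro!: homog_mult)
      then show "?f x = 0" unfolding rs prod.case by (rule homog_orthogonal)
    qed
  qed auto
  finally show ?thesis by (simp add: hinner_nu_poly)
qed

theorem theorem10p1:
  fixes p :: "complex poly poly"
    and pc :: "nat \<Rightarrow> complex poly poly"
    and a b :: nat
  assumes "p \<noteq> 0"
    and "a \<le> b"
    and "\<And>j. j \<in> {a..b} \<Longrightarrow> pc j \<in> homog j"
    and "p = (\<Sum>j = a..b. pc j)"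
    and "pc a \<noteq> 0"
    and "pc b \<noteq> 0"
  shows
    "(\<exists>U. extends_mult_unitary p U \<and>
        (\<forall>x\<in>hcarrier (P2 p). U (S_z p x) = R_z (U x)) \<and>
        (\<forall>x\<in>hcarrier (P2 p). U (S_w p x) = R_w (U x)))
     \<and>
     (\<forall>U. extends_mult_unitary p U \<longrightarrow>
        (\<forall>x\<in>hcarrier (P2 p).
           adjoint_op (P2 p) (principal_submodule p) U
             (wandering_proj (principal_submodule p) R_z (U x))
             = wandering_proj (P2 p) (S_z p) x \<and>
           adjoint_op (P2 p) (principal_submodule p) U
             (wandering_proj (principal_submodule p) R_w (U x))
             = wandering_proj (P2 p) (S_w p) x \<and>
           adjoint_op (P2 p) (principal_submodule p) U
             (cross_commutator (principal_submodule p) R_z R_w (U x))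
             = cross_commutator (P2 p) (S_z p) (S_w p) x \<and>
           adjoint_op (P2 p) (principal_submodule p) U
             (defect_op (principal_submodule p) R_z R_w (U x))
             = defect_op (P2 p) (S_z p) (S_w p) x))
     \<and>
     (\<forall>m n. \<forall>h\<in>homog m. \<forall>g\<in>homog n.
        hinner (P2 p) (nu_poly p h) (nu_poly p g) =
          complex_of_real (1 / (torus_norm p)\<^sup>2) *
          (\<Sum>(r, s) \<in> {(r, s). a \<le> r \<and> r \<le> b \<and> a \<le> s \<and> s \<le> b \<and> m + r = n + s}.
             hinner hardy2 (hardy_poly (pc r * h)) (hardy_poly (pc s * g))))
     \<and>
     (\<forall>m n. \<bar>int m - int n\<bar> > int b - int a \<longrightarrow>
        (\<forall>h\<in>homog m. \<forall>g\<in>homog n. hinner (P2 p) (nu_poly p h) (nu_poly p g) = 0))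
     \<and>
     ((\<forall>m n. m \<noteq> n \<longrightarrow>
        (\<forall>h\<in>homog m. \<forall>g\<in>homog n. hinner (P2 p) (nu_poly p h) (nu_poly p g) = 0))
      \<longleftrightarrow> (\<exists>d. p \<in> homog d))"
proof -
  have "\<forall>j\<in>{a..b}. pc j \<in> homog j" using assms(3) by blast
  note inner = hinner_nu_poly_homog[OF this assms(4)]
  have conj: "adjoint_op (P2 p) (principal_submodule p) U
             (wandering_proj (principal_submodule p) R_z (U x))
             = wandering_proj (P2 p) (S_z p) x \<and>
           adjoint_op (P2 p) (principal_submodule p) U
             (wandering_proj (principal_submodule p) R_w (U x))
             = wandering_proj (P2 p) (S_w p) x \<and>
           adjoint_op (P2 p) (principal_submodule p) U
             (cross_commutator (principal_submodule p) R_z R_w (U x))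
             = cross_commutator (P2 p) (S_z p) (S_w p) x \<and>
           adjoint_op (P2 p) (principal_submodule p) U
             (defect_op (principal_submodule p) R_z R_w (U x))
             = defect_op (P2 p) (S_z p) (S_w p) x"
    if ext: "extends_mult_unitary p U" and x: "x \<in> hcarrier (P2 p)" for U x
  proof -
    interpret unitary_pair "P2 p" "principal_submodule p" U
      using ext hilbert_P2 hilbert_principal_submodule
      by (simp add: unitary_pair_def unitary_pair_axioms_def extends_mult_unitary_def)
    note tw = extends_mult_unitary_intertwines[OF ext]
    note zw = isometry_S_z isometry_S_w isometry_R_principal_submodule tw
    \<comment> \<open>The conjugation lemma speaks of the first operator of a pair, so P_w is
      obtained with z and w exchanged.\<close>
    note wz = isometry_S_w isometry_S_z isometry_R_principal_submodule(2,1) tw(2,1)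
    show ?thesis
      using conj_wandering_proj[OF zw x] conj_wandering_proj[OF wz x]
        conj_cross_commutator[OF zw x] conj_defect_op[OF zw x] by blast
  qed
  have far: "hinner (P2 p) (nu_poly p h) (nu_poly p g) = 0"
    if "\<bar>int m - int n\<bar> > int b - int a" "h \<in> homog m" "g \<in> homog n" for m n h g
  proof -
    \<comment> \<open>m + r = n + s gives |m - n| = |r - s| <= b - a, so no pair
      contributes.\<close>
    have "{(r, s). a \<le> r \<and> r \<le> b \<and> a \<le> s \<and> s \<le> b \<and> m + r = n + s} = {}"
      using that(1) by auto
    then show ?thesis by (simp only: inner[OF that(2,3)]) simp
  qed
  have orth_imp: "\<exists>d. p \<in> homog d" if orth: "\<forall>m n. m \<noteq> n \<longrightarrow>
      (\<forall>h\<in>homog m. \<forall>g\<in>homog n. hinner (P2 p) (nu_poly p h) (nu_poly p g) = 0)"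
  proof (cases "a = b")
    case True
    then show ?thesis using assms(3)[of a] assms(4) by auto
  next
    case False
    \<comment> \<open>For \<open>h = p\<^sub>b\<close> and \<open>g = p\<^sub>a\<close> only the term \<open>\<parallel>p\<^sub>a p\<^sub>b\<parallel>\<^sup>2\<close> survives.\<close>
    have hom: "pc a \<in> homog a" "pc b \<in> homog b" using assms(2,3) by auto
    \<comment> \<open>b + r >= b + a >= a + s, with equality only for r = a and s = b.\<close>
    have "{(r, s). a \<le> r \<and> r \<le> b \<and> a \<le> s \<and> s \<le> b \<and> b + r = a + s} = {(a, b)}"
      using assms(2) by auto
    moreover have "hinner (P2 p) (nu_poly p (pc b)) (nu_poly p (pc a)) = 0"
      using orth hom False by metis
    ultimately have "hinner hardy2 (hardy_poly (pc a * pc b)) (hardy_poly (pc b * pc a)) = 0"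
      using inner[OF hom(2,1)] torus_norm_pos[OF assms(1)] by simp
    then have "pc a * pc b = 0"
      by (intro hardy_poly_inner_self_eq_0) (simp add: mult.commute)
    \<comment> \<open>C[z, w] has no zero divisors, so a vanishing product contradicts the choice of
      the extreme components.\<close>
    then show ?thesis using assms(5,6) by simp
  qed
  \<comment> \<open>Here the degree d of p is used directly: p h and p g are homogeneous of the
    different degrees d + m and d + n.\<close>
  have hom_imp: "hinner (P2 p) (nu_poly p h) (nu_poly p g) = 0"
    if "p \<in> homog d" "m \<noteq> n" "h \<in> homog m" "g \<in> homog n" for d m n h g
  proof -
    have "hinner hardy2 (hardy_poly (p * h)) (hardy_poly (p * g)) = 0"
      using that by (intro homog_orthogonal[of _ "d + m" _ "d + n"] homog_mult) auto
    then show ?thesis by (simp add: hinner_nu_poly)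
  qed
  have ex: "\<exists>U. extends_mult_unitary p U \<and>
        (\<forall>x\<in>hcarrier (P2 p). U (S_z p x) = R_z (U x)) \<and>
        (\<forall>x\<in>hcarrier (P2 p). U (S_w p x) = R_w (U x))"
    using ex_mult_unitary[OF assms(1)] extends_mult_unitary_intertwines by blast
  show ?thesis
  proof (intro conjI)
    show "(\<forall>m n. m \<noteq> n \<longrightarrow>
        (\<forall>h\<in>homog m. \<forall>g\<in>homog n. hinner (P2 p) (nu_poly p h) (nu_poly p g) = 0))
      \<longleftrightarrow> (\<exists>d. p \<in> homog d)"
      using orth_imp hom_imp by blast
  qed (rule ex, intro allI impI ballI, erule (1) conj, intro allI ballI, erule (1) inner,
      intro allI impI ballI, erule (2) far)
qed

end
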